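(* Let $k\geq 0$, let $\omega\in\Omega^k_{\mathrm{can}}$ be a canonical form of degree $k$, and let $G$ be a connected graph with exactly $k+1$ edges. Then the integral $$I_G(\omega)=\int_{\sigma_G}\omega_G$$ is finite (convergent).
   Context: Graphs are finite; multiple edges and self-loops are allowed. $E_G$ is the edge set of $G$. $\mathbb{P}^{E_G}$ is the projective space over $\mathbb{Q}$ of dimension $|E_G|-1$ with homogeneous coordinates $x_e$, $e\in E_G$, and $\sigma_G=\{(x_e): x_e>0 \text{ for all } e\}\subset\mathbb{P}^{E_G}(\mathbb{R})$ is the open coordinate simplex (with a chosen orientation). Graph Laplacian: choose an orientation of each edge; then $H_1(G;\mathbb{Z})\subset\mathbb{Z}^{E_G}$. Choose a basis of $H_1(G;\mathbb{Z})$ (rank $h_G$), let $\mathcal{H}_G$ be the $|E_G|\times h_G$ matrix of the inclusion, $D_G$ the diagonal matrix with entries $x_e$, and $\Lambda_G=\mathcal{H}_G^TD_G\mathcal{H}_G$. For $k\ge 1$ put $\omega^{4k+1}_G=\mathrm{tr}((\Lambda_G^{-1}d\Lambda_G)^{4k+1})$. It is independent of choices and defines a projective differential form on $\mathbb{P}^{E_G}\setminus V(\det\Lambda_G)$, smooth on $\sigma_G$. $\Omega^\bullet_{\mathrm{can}}$ is the graded exterior algebra over $\mathbb{Q}$ on generators $\omega^{4k+1}$ of degree $4k+1$, one for each $k\geq1$; its elements are called canonical forms. For a canonical form $\omega$, $\omega_G$ is the differential form obtained by replacing each generator $\omega^{4k+1}$ by $\omega^{4k+1}_G$ and taking exterior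 products. *)

theory Defs
  imports
    "HOL-Analysis.Analysis"
    "Jordan_Normal_Form.Gauss_Jordan_Elimination"
    "Graph_Theory.Digraph_Component"
begin

section \<open>Exterior algebras\<close>

text \<open>
  The exterior algebra over a commutative ring on a linearly ordered set of generators \<open>g\<^sub>i\<close>.
  An element is given by its coefficients in the standard basis consisting of the products
  \<open>g\<^sub>I = g\<^bsub>i1\<^esub> \<and> \<dots> \<and> g\<^bsub>ir\<^esub>\<close> for finite \<open>I = {i1 < \<dots> < ir}\<close>.
\<close>

typedef (overloaded) ('i, 'a::zero) exterior =
  "{f :: 'i set \<Rightarrow> 'a. finite {I. f I \<noteq> 0} \<and> (\<forall>I. infinite I \<longrightarrow> f I = 0)}"
  morphisms ecoeff Abs_exterior
  by (rule exI[of _ "\<lambda>_. 0"]) auto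

setup_lifting type_definition_exterior

text \<open>For disjoint \<open>I\<close>, \<open>J\<close> the product of the basis elements \<open>g\<^sub>I\<close> and \<open>g\<^sub>J\<close> is the basis
  element of \<open>I \<union> J\<close> times the sign of the permutation that sorts the concatenation.\<close>

definition shuffle_sign :: "'i::linorder set \<Rightarrow> 'i set \<Rightarrow> 'a::comm_ring_1" where
  "shuffle_sign I J = (-1) ^ card {(i, j). i \<in> I \<and> j \<in> J \<and> j < i}"

lemma finite_inversions:
  "finite I \<Longrightarrow> finite J \<Longrightarrow> finite {(i, j). i \<in> I \<and> j \<in> J \<and> j < i}"
  by (rule finite_subset[of _ "I \<times> J"]) auto

lemma shuffle_sign_Un_left:
  assumes "finite I" "finite J" "finite L" "I \<inter> J = {}"
  shows "shuffle_sign (I \<union> J) L = (shuffle_sign I L * shuffle_sign J L :: 'a::comm_ring_1)"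
proof -
  have "{(i, j). i \<in> I \<union> J \<and> j \<in> L \<and> j < i}
      = {(i, j). i \<in> I \<and> j \<in> L \<and> j < i} \<union> {(i, j). i \<in> J \<and> j \<in> L \<and> j < i}" by auto
  moreover have "{(i, j). i \<in> I \<and> j \<in> L \<and> j < i} \<inter> {(i, j). i \<in> J \<and> j \<in> L \<and> j < i} = {}"
    using assms by auto
  ultimately show ?thesis
    using assms by (simp add: shuffle_sign_def card_Un_disjoint finite_inversions power_add)
qed

lemma shuffle_sign_Un_right:
  assumes "finite I" "finite J" "finite L" "J \<inter> L = {}"
  shows "shuffle_sign I (J \<union> L) = (shuffle_sign I J * shuffle_sign I L :: 'a::comm_ring_1)"
proof -
  have "{(i, j). i \<in> I \<and> j \<in> J \<union> L \<and> j < i}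
      = {(i, j). i \<in> I \<and> j \<in> J \<and> j < i} \<union> {(i, j). i \<in> I \<and> j \<in> L \<and> j < i}" by auto
  moreover have "{(i, j). i \<in> I \<and> j \<in> J \<and> j < i} \<inter> {(i, j). i \<in> I \<and> j \<in> L \<and> j < i} = {}"
    using assms by auto
  ultimately show ?thesis
    using assms by (simp add: shuffle_sign_def card_Un_disjoint finite_inversions power_add)
qed

lemma shuffle_sign_empty [simp]: "shuffle_sign {} J = 1" "shuffle_sign I {} = 1"
  by (simp_all add: shuffle_sign_def)

definition wedge_coeff ::
    "('i::linorder set \<Rightarrow> 'a::comm_ring_1) \<Rightarrow> ('i set \<Rightarrow> 'a) \<Rightarrow> 'i set \<Rightarrow> 'a" where
  "wedge_coeff f g K = (\<Sum>I\<in>Pow K. shuffle_sign I (K - I) * f I * g (K - I))"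

lemma wedge_coeff_assoc:
  fixes f g h :: "'i::linorder set \<Rightarrow> 'a::comm_ring_1"
  assumes K: "finite K"
  shows "wedge_coeff (wedge_coeff f g) h K = wedge_coeff f (wedge_coeff g h) K"
proof -
  have sub: "finite A" if "A \<subseteq> K" for A using that K by (rule finite_subset)
  have "wedge_coeff (wedge_coeff f g) h K
      = (\<Sum>(I, J)\<in>Sigma (Pow K) Pow.
          shuffle_sign I (K - I) * (shuffle_sign J (I - J) * f J * g (I - J)) * h (K - I))"
    unfolding wedge_coeff_def using K sub
    by (subst sum.Sigma[symmetric]) (auto simp: sum_distrib_left sum_distrib_right)
  also have "\<dots> = (\<Sum>(J, M)\<in>Sigma (Pow K) (\<lambda>J. Pow (K - J)).
          shuffle_sign J (K - J) * f J *
            (shuffle_sign M (K - J - M) * g M * h (K - J - M)))"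
  proof (rule sum.reindex_bij_witness[of _ "\<lambda>(J, M). (J \<union> M, J)" "\<lambda>(I, J). (J, I - J)"],
      goal_cases)
    case (5 p)
    then obtain I J where p: "p = (I, J)" "I \<subseteq> K" "J \<subseteq> I" by auto
    define M where "M = I - J"
    define L where "L = K - I"
    have eqs: "I = J \<union> M" "K - J = M \<union> L" "K - J - M = L" "K - J - (I - J) = L"
      using p by (auto simp: M_def L_def)
    have fin: "finite J" "finite M" "finite L"
      using p sub by (auto simp: M_def L_def)
    have disj: "J \<inter> M = {}" "M \<inter> L = {}" by (auto simp: M_def L_def p)
    have sign: "shuffle_sign I L * shuffle_sign J M
        = (shuffle_sign J (K - J) * shuffle_sign M L :: 'a)"
      unfolding eqs(1,2) using fin disj
      by (simp add: shuffle_sign_Un_left shuffle_sign_Un_right mult_ac)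
    have "shuffle_sign J (K - J) * f J * (shuffle_sign M L * g M * h L)
        = (shuffle_sign J (K - J) * shuffle_sign M L) * (f J * g M * h L)"
      by (simp only: mult_ac)
    also have "\<dots> = shuffle_sign I L * (shuffle_sign J M * f J * g M) * h L"
      unfolding sign[symmetric] by (simp only: mult_ac)
    finally show ?case
      unfolding p prod.case eqs(4) M_def[symmetric] L_def[symmetric] eqs(3) .
  qed auto
  also have "\<dots> = wedge_coeff f (wedge_coeff g h) K"
    unfolding wedge_coeff_def using K sub
    by (subst sum.Sigma[symmetric]) (auto simp: sum_distrib_left sum_distrib_right)
  finally show ?thesis .
qed

lemma wedge_coeff_infinite:
  assumes "\<forall>I. infinite I \<longrightarrow> f I = 0" "\<forall>I. infinite I \<longrightarrow> g I = 0" "infinite K"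
  shows "wedge_coeff f g K = 0"
  unfolding wedge_coeff_def
proof (rule sum.neutral, rule ballI)
  fix I assume "I \<in> Pow K"
  then have "infinite I \<or> infinite (K - I)" using assms(3) by (metis finite_Diff2)
  then have "f I = 0 \<or> g (K - I) = 0" using assms(1,2) by blast
  then show "shuffle_sign I (K - I) * f I * g (K - I) = 0" by (metis mult_zero_left mult_zero_right)
qed

instantiation exterior :: (linorder, comm_ring_1) ring_1
begin

lift_definition zero_exterior :: "('a, 'b) exterior" is "\<lambda>_. 0"
  by simp

lift_definition one_exterior :: "('a, 'b) exterior" is "\<lambda>I. if I = {} then 1 else 0"
  by auto

lift_definition plus_exterior :: "('a, 'b) exterior \<Rightarrow> ('a, 'b) exterior \<Rightarrow> ('a, 'b) exterior"
  is "\<lambda>f g I. f I + g I"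
proof safe
  fix f g :: "'a set \<Rightarrow> 'b"
  assume "finite {I. f I \<noteq> 0}" "finite {I. g I \<noteq> 0}"
  then have "finite ({I. f I \<noteq> 0} \<union> {I. g I \<noteq> 0})" by simp
  then show "finite {I. f I + g I \<noteq> 0}" by (rule rev_finite_subset) auto
qed auto

lift_definition uminus_exterior :: "('a, 'b) exterior \<Rightarrow> ('a, 'b) exterior"
  is "\<lambda>f I. - f I"
  by simp

definition minus_exterior :: "('a, 'b) exterior \<Rightarrow> ('a, 'b) exterior \<Rightarrow> ('a, 'b) exterior" where
  "minus_exterior f g = f + - g"

lift_definition times_exterior :: "('a, 'b) exterior \<Rightarrow> ('a, 'b) exterior \<Rightarrow> ('a, 'b) exterior"
  is wedge_coeff
proof (rule conjI)
  fix f g :: "'a set \<Rightarrow> 'b"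
  assume f: "finite {I. f I \<noteq> 0} \<and> (\<forall>I. infinite I \<longrightarrow> f I = 0)"
    and g: "finite {I. g I \<noteq> 0} \<and> (\<forall>I. infinite I \<longrightarrow> g I = 0)"
  have "{K. wedge_coeff f g K \<noteq> 0} \<subseteq> (\<lambda>(I, J). I \<union> J) ` ({I. f I \<noteq> 0} \<times> {I. g I \<noteq> 0})"
  proof
    fix K assume "K \<in> {K. wedge_coeff f g K \<noteq> 0}"
    then obtain I where I: "I \<in> Pow K" "shuffle_sign I (K - I) * f I * g (K - I) \<noteq> 0"
      unfolding wedge_coeff_def by (auto elim: sum.not_neutral_contains_not_neutral)
    then have "f I \<noteq> 0" "g (K - I) \<noteq> 0" "K = I \<union> (K - I)" by auto
    then show "K \<in> (\<lambda>(I, J). I \<union> J) ` ({I. f I \<noteq> 0} \<times> {I. g I \<noteq> 0})"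
      by (intro image_eqI[of _ _ "(I, K - I)"]) auto
  qed
  then show "finite {K. wedge_coeff f g K \<noteq> 0}"
    using f g by (auto intro: finite_subset)
  show "\<forall>K. infinite K \<longrightarrow> wedge_coeff f g K = 0"
    using f g wedge_coeff_infinite by blast
qed

instance
proof
  fix a b c :: "('a, 'b) exterior"
  show "a + b + c = a + (b + c)" by transfer (auto simp: add.assoc)
  show "a + b = b + a" by transfer (auto simp: add.commute)
  show "0 + a = a" by transfer auto
  show "- a + a = 0" by transfer auto
  show "a - b = a + - b" by (simp add: minus_exterior_def)
  show "(0::('a, 'b) exterior) \<noteq> 1" by transfer (auto simp: fun_eq_iff)
  show "(a + b) * c = a * c + b * c"
    by transfer (auto simp: wedge_coeff_def fun_eq_iff algebra_simps sum.distrib)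
  show "a * (b + c) = a * b + a * c"
    by transfer (auto simp: wedge_coeff_def fun_eq_iff algebra_simps sum.distrib)
  show "a * b * c = a * (b * c)"
  proof (transfer, rule ext)
    fix f g h :: "'a set \<Rightarrow> 'b" and K
    assume fgh: "finite {I. f I \<noteq> 0} \<and> (\<forall>I. infinite I \<longrightarrow> f I = 0)"
      "finite {I. g I \<noteq> 0} \<and> (\<forall>I. infinite I \<longrightarrow> g I = 0)"
      "finite {I. h I \<noteq> 0} \<and> (\<forall>I. infinite I \<longrightarrow> h I = 0)"
    show "wedge_coeff (wedge_coeff f g) h K = wedge_coeff f (wedge_coeff g h) K"
    proof (cases "finite K")
      case True
      then show ?thesis by (rule wedge_coeff_assoc)
    next
      case False
      with fgh show ?thesis by (simp add: wedge_coeff_infinite)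
    qed
  qed
  show "1 * a = a"
  proof (transfer, rule ext)
    fix f :: "'a set \<Rightarrow> 'b" and K
    assume f: "finite {I. f I \<noteq> 0} \<and> (\<forall>I. infinite I \<longrightarrow> f I = 0)"
    have "wedge_coeff (\<lambda>I. if I = {} then 1 else 0) f K = (\<Sum>I\<in>{{}::'a set}. f K)" if "finite K"
      unfolding wedge_coeff_def by (rule sum.mono_neutral_cong_right) (use that in auto)
    then show "wedge_coeff (\<lambda>I. if I = {} then 1 else 0) f K = f K"
      using f by (cases "finite K") (auto simp: wedge_coeff_infinite)
  qed
  show "a * 1 = a"
  proof (transfer, rule ext)
    fix f :: "'a set \<Rightarrow> 'b" and K
    assume f: "finite {I. f I \<noteq> 0} \<and> (\<forall>I. infinite I \<longrightarrow> f I = 0)"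
    have "wedge_coeff f (\<lambda>I. if I = {} then 1 else 0) K = (\<Sum>I\<in>{K}. f I)" if "finite K"
      unfolding wedge_coeff_def by (rule sum.mono_neutral_cong_right) (use that in auto)
    then show "wedge_coeff f (\<lambda>I. if I = {} then 1 else 0) K = f K"
      using f by (cases "finite K") (auto simp: wedge_coeff_infinite)
  qed
qed

end

lift_definition ext_const :: "'a::comm_ring_1 \<Rightarrow> ('i::linorder, 'a) exterior"
  is "\<lambda>c I. if I = {} then c else 0"
  by (auto intro: finite_subset[of _ "{{}}"])

lift_definition ext_gen :: "'i::linorder \<Rightarrow> ('i, 'a::comm_ring_1) exterior"
  is "\<lambda>i I. if I = {i} then 1 else 0"
  by auto

lemma shuffle_sign_singletons:
  "shuffle_sign {i} {j} = (if j < i then -1 else 1)"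
proof -
  have "{(i', j'). i' \<in> {i} \<and> j' \<in> {j} \<and> j' < i'} = (if j < i then {(i, j)} else {})"
    by auto
  then show ?thesis by (simp add: shuffle_sign_def)
qed

lemma ecoeff_gen_mult:
  "ecoeff (ext_gen i * ext_gen j :: ('i::linorder, 'a::comm_ring_1) exterior) K
    = (if i \<noteq> j \<and> K = {i, j} then if j < i then -1 else 1 else 0)"
proof (cases "i \<noteq> j \<and> K = {i, j}")
  case True
  then have "K - {i} = {j}" by auto
  have "ecoeff (ext_gen i * ext_gen j :: ('i, 'a) exterior) K
      = (\<Sum>I\<in>{{i}}. shuffle_sign {i} {j})"
    unfolding times_exterior.rep_eq wedge_coeff_def ext_gen.rep_eq
    by (rule sum.mono_neutral_cong_right) (use True \<open>K - {i} = {j}\<close> in auto)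
  with True show ?thesis by (simp add: shuffle_sign_singletons)
next
  case False
  then have "\<not> (I = {i} \<and> K - I = {j})" if "I \<in> Pow K" for I using that by auto
  then have "ecoeff (ext_gen i * ext_gen j :: ('i, 'a) exterior) K = 0"
    unfolding times_exterior.rep_eq wedge_coeff_def ext_gen.rep_eq
    by (intro sum.neutral) auto
  with False show ?thesis by (simp only: if_False)
qed

lemma ext_gen_square: "ext_gen i * ext_gen i = 0"
  by (simp add: ecoeff_inject[symmetric] fun_eq_iff ecoeff_gen_mult zero_exterior.rep_eq)

lemma ext_gen_anticommute:
  "(ext_gen i * ext_gen j :: ('i::linorder, 'a::comm_ring_1) exterior) = - (ext_gen j * ext_gen i)"
proof -
  have "ecoeff (ext_gen i * ext_gen j :: ('i, 'a) exterior) K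
      = - ecoeff (ext_gen j * ext_gen i :: ('i, 'a) exterior) K" for K
  proof (cases "i \<noteq> j \<and> K = {i, j}")
    case True
    then have *: "j \<noteq> i \<and> K = {j, i}" and "j < i \<longleftrightarrow> \<not> i < j" by auto
    then show ?thesis
      unfolding ecoeff_gen_mult if_P[OF True] if_P[OF *] by simp
  next
    case False
    then have "\<not> (j \<noteq> i \<and> K = {j, i})" by auto
    with False show ?thesis by (simp only: ecoeff_gen_mult if_False minus_zero)
  qed
  then show ?thesis
    by (simp add: ecoeff_inject[symmetric] fun_eq_iff uminus_exterior.rep_eq)
qed

section \<open>Canonical forms\<close>

text \<open>\<open>\<Omega>\<^sub>c\<^sub>a\<^sub>n\<close> is the subalgebra of \<open>(nat, rat) exterior\<close> on the generators with index at least 1;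
  the generator with index \<open>j\<close> stands for \<open>\<omega>\<close> with upper index \<open>4j+1\<close>.\<close>

definition canonical_forms :: "nat \<Rightarrow> (nat, rat) exterior set" where
  "canonical_forms d =
     {\<omega>. \<forall>K. ecoeff \<omega> K \<noteq> 0 \<longrightarrow> K \<subseteq> {1..} \<and> (\<Sum>j\<in>K. 4 * j + 1) = d}"

section \<open>Graph Laplacians\<close>

text \<open>
  A graph is given as a finite multi-digraph \<open>G\<close> (loops and parallel arcs allowed); the direction
  of the arcs is the chosen orientation of the edges. The list \<open>es\<close> enumerates the edges, so that
  \<open>\<int>\<^bsup>E\<^esup>\<close> becomes \<open>carrier_vec (length es)\<close> and the coordinate \<open>x\<^sub>e\<close> of \<open>e = es ! i\<close> becomes
  \<open>x i\<close>. The order of \<open>es\<close> also determines the orientation of the simplex.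
\<close>

definition H1 :: "('v, 'e) pre_digraph \<Rightarrow> 'e list \<Rightarrow> int Matrix.vec set" where
  "H1 G es = {c \<in> carrier_vec (length es). \<forall>v\<in>verts G.
     (\<Sum>i<length es. if head G (es ! i) = v then vec_index c i else 0)
       - (\<Sum>i<length es. if tail G (es ! i) = v then vec_index c i else 0) = 0}"

text \<open>The columns of \<open>H\<close> form a \<open>\<int>\<close>-basis of \<open>H1 G es\<close>.\<close>

definition H1_basis :: "('v, 'e) pre_digraph \<Rightarrow> 'e list \<Rightarrow> int mat \<Rightarrow> bool" where
  "H1_basis G es H \<longleftrightarrow> dim_row H = length es \<and>
     bij_betw (\<lambda>a. H *\<^sub>v a) (carrier_vec (dim_col H)) (H1 G es)"

definition laplacian :: "int mat \<Rightarrow> (nat \<Rightarrow> real) \<Rightarrow> real mat" where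
  "laplacian H x =
     transpose_mat (map_mat of_int H) * mat_diag (dim_row H) x * map_mat of_int H"

section \<open>Differential forms\<close>

text \<open>A differential form in the coordinates \<open>x 0, \<dots>, x (n - 1)\<close>, with \<open>ext_gen i\<close> in the role
  of \<open>dx\<^sub>i\<close>.\<close>

type_synonym form = "(nat \<Rightarrow> real) \<Rightarrow> (nat, real) exterior"

definition diff :: "nat \<Rightarrow> ((nat \<Rightarrow> real) \<Rightarrow> real) \<Rightarrow> form" where
  "diff n f x = (\<Sum>i<n. ext_const (deriv (\<lambda>t. f (x(i := t))) (x i)) * ext_gen i)"

definition diff_mat ::
    "nat \<Rightarrow> ((nat \<Rightarrow> real) \<Rightarrow> real mat) \<Rightarrow> (nat \<Rightarrow> real) \<Rightarrow> (nat, real) exterior mat" where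
  "diff_mat n A x = Matrix.mat (dim_row (A x)) (dim_col (A x))
     (\<lambda>(i, j). diff n (\<lambda>x. A x $$ (i, j)) x)"

definition mat_trace :: "'a::comm_monoid_add mat \<Rightarrow> 'a" where
  "mat_trace A = (\<Sum>i<dim_row A. A $$ (i, i))"

definition omega :: "int mat \<Rightarrow> nat \<Rightarrow> form" where
  "omega H j x = mat_trace
     ((map_mat ext_const (the (mat_inverse (laplacian H x)))
        * diff_mat (dim_row H) (laplacian H) x) ^\<^sub>m (4 * j + 1))"

text \<open>The image of \<open>\<omega>\<close> under the algebra homomorphism that sends the generator \<open>j\<close> to
  \<open>omega H j\<close>; the basis element of \<open>K\<close> is the product of its generators in increasing order.\<close>

definition canonical_form :: "int mat \<Rightarrow> (nat, rat) exterior \<Rightarrow> form" where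
  "canonical_form H \<omega> x = (\<Sum>K | ecoeff \<omega> K \<noteq> 0. ext_const (of_rat (ecoeff \<omega> K)) *
     prod_list (map (\<lambda>j. omega H j x) (sorted_list_of_set K)))"

section \<open>Integrals over the simplex\<close>

text \<open>
  For a projective form \<open>\<eta>\<close> of degree \<open>k\<close> in \<open>k + 1\<close> homogeneous coordinates. The affine chart
  \<open>x k = 1\<close> identifies \<open>\<sigma>\<close> with the open orthant of \<open>\<real>\<^bsup>k\<^esup>\<close>; there \<open>dx\<^sub>k\<close> restricts to \<open>0\<close>, so
  that \<open>\<eta>\<close> restricts to its coefficient at \<open>dx\<^sub>0 \<and> \<dots> \<and> dx\<^bsub>k-1\<^esub>\<close> times the volume form.
  Convergence of the integral is understood in the absolute sense of Lebesgue integration.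
\<close>

definition simplex_integrable :: "nat \<Rightarrow> form \<Rightarrow> bool" where
  "simplex_integrable k \<eta> \<longleftrightarrow>
     set_integrable (\<Pi>\<^sub>M i\<in>{..<k}. lborel) (\<Pi>\<^sub>E i\<in>{..<k}. {0<..})
       (\<lambda>y. ecoeff (\<eta> (y(k := 1))) {..<k})"

end

theory Submission
  imports Defs "Jordan_Normal_Form.Determinant"
begin

text \<open>
  In logarithmic differentials \<open>dx\<^sub>e / x\<^sub>e\<close> the form \<open>\<omega>\<close> with upper index \<open>m = 4j+1\<close> is
  \<open>tr ((\<Theta> Q)\<^sup>m)\<close>, where \<open>\<Theta>\<close> is the diagonal matrix of the \<open>dx\<^sub>e / x\<^sub>e\<close> and \<open>Q\<close> is the orthogonal
  projection onto the column space of \<open>D\<^bsup>1/2\<^esup> H\<close>. Since \<open>Q\<close> is bounded, the integrand is at most a constant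
  times \<open>1 / \<Prod>x\<^sub>e\<close>, which just fails to be integrable; some decay has to be gained.

  Let \<open>S\<close> be a nonempty set of edges that does not contain the edge \<open>k\<close> with \<open>x\<^sub>k = 1\<close>. Contraction with the Euler
  field of \<open>S\<close> does not lose the relevant coefficient. On the other hand, if \<open>Q\<close> commutes with the
  coordinate projection onto \<open>S\<close>, then this contraction kills the form, because traces of even powers
  vanish by graded cyclicity. Hence the integrand times \<open>\<Prod>x\<^sub>e\<close> is bounded by the entries of \<open>Q\<close> between
  \<open>S\<close> and its complement. The oblique projections \<open>D\<^bsup>-1/2\<^esup> Q D\<^bsup>1/2\<^esup>\<close> are bounded uniformly in \<open>x\<close>, so that
  these entries are at most a constant times \<open>exp (- \<bar>ln x\<^sub>e - ln x\<^sub>f\<bar> / 2)\<close>. Cutting at the largest gap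
  between the \<open>ln x\<^sub>e\<close> bounds the integrand by a product of integrable functions of the single \<open>x\<^sub>e\<close>.
\<close>

section \<open>Exterior algebra\<close>


text \<open>Coefficients at infinite sets vanish by construction of the type, so comparing finite
  index sets is enough.\<close>

lemma exterior_eqI:
  assumes "\<And>I. finite I \<Longrightarrow> ecoeff a I = ecoeff b I"
  shows "a = b"
proof -
  have "ecoeff a I = ecoeff b I" for I
    using assms[of I] ecoeff[of a] ecoeff[of b] by (cases "finite I") auto
  then show ?thesis by (simp add: ecoeff_inject[symmetric] fun_eq_iff)
qed

lemma ecoeff_mult:
  "ecoeff (a * b) K = (\<Sum>I\<in>Pow K. shuffle_sign I (K - I) * ecoeff a I * ecoeff b (K - I))"
  by (simp add: times_exterior.rep_eq wedge_coeff_def)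

lemma ecoeff_sum: "ecoeff (sum f A) K = (\<Sum>i\<in>A. ecoeff (f i) K)"
  by (induction A rule: infinite_finite_induct) (auto simp: zero_exterior.rep_eq plus_exterior.rep_eq)

lemma ecoeff_const_mult:
  fixes K :: "'i::linorder set"
  assumes K: "finite K"
  shows "ecoeff (ext_const c * a) K = c * ecoeff a K"
proof -
  have "ecoeff (ext_const c * a) K = (\<Sum>I\<in>{{}::'i set}. c * ecoeff a K)"
    unfolding ecoeff_mult ext_const.rep_eq
    by (rule sum.mono_neutral_cong_right) (use K in auto)
  then show ?thesis by simp
qed

lemma ecoeff_mult_const:
  assumes K: "finite K"
  shows "ecoeff (a * ext_const c) K = ecoeff a K * c"
proof -
  have "ecoeff (a * ext_const c) K = (\<Sum>I\<in>{K}. ecoeff a K * c)"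
    unfolding ecoeff_mult ext_const.rep_eq
    by (rule sum.mono_neutral_cong_right) (use K in auto)
  then show ?thesis by simp
qed

lemma ext_const_commute: "a * ext_const c = ext_const c * a"
  by (rule exterior_eqI) (simp add: ecoeff_mult_const ecoeff_const_mult)

lemma ext_const_left_commute: "a * (ext_const c * b) = ext_const c * (a * b)"
  by (metis ext_const_commute mult.assoc)

interpretation ext_const: ring_hom "ext_const :: 'a::comm_ring_1 \<Rightarrow> ('i::linorder, 'a) exterior"
proof
  show "ext_const (x + y) = (ext_const x + ext_const y :: ('i, 'a) exterior)" for x y :: 'a
    by (rule exterior_eqI) (simp add: ext_const.rep_eq plus_exterior.rep_eq)
  show "ext_const (x * y) = (ext_const x * ext_const y :: ('i, 'a) exterior)" for x y :: 'a
    by (rule exterior_eqI) (simp only: ecoeff_const_mult, simp add: ext_const.rep_eq)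
  show "ext_const 0 = (0 :: ('i, 'a) exterior)"
    by (rule exterior_eqI) (simp add: ext_const.rep_eq zero_exterior.rep_eq)
  show "ext_const 1 = (1 :: ('i, 'a) exterior)"
    by (rule exterior_eqI) (simp add: ext_const.rep_eq one_exterior.rep_eq)
qed

lemma shuffle_sign_square [simp]: "shuffle_sign I J * shuffle_sign I J = 1"
  by (simp add: shuffle_sign_def power_add[symmetric] flip: mult_2)

lemma abs_shuffle_sign [simp]: "\<bar>shuffle_sign I J :: 'a::linordered_idom\<bar> = 1"
  by (simp add: shuffle_sign_def power_abs)

text \<open>Every pair in \<open>I \<times> J\<close> is an inversion for exactly one of the two
  orders of concatenation, because disjointness excludes equal entries. The two inversion counts
  therefore add up to \<open>card I * card J\<close>.\<close>

lemma shuffle_sign_swap: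
  assumes "finite I" "finite J" "I \<inter> J = {}"
  shows "shuffle_sign I J * shuffle_sign J I = (-1) ^ (card I * card J)"
proof -
  have swap: "card {(j, i). j \<in> J \<and> i \<in> I \<and> i < j} = card {(i, j). i \<in> I \<and> j \<in> J \<and> i < j}"
    by (rule bij_betw_same_card[of "\<lambda>(x, y). (y, x)"])
      (auto simp: bij_betw_def inj_on_def image_def)
  have "I \<times> J = {(i, j). i \<in> I \<and> j \<in> J \<and> j < i} \<union> {(i, j). i \<in> I \<and> j \<in> J \<and> i < j}"
    using assms(3) by force
  moreover have "{(i, j). i \<in> I \<and> j \<in> J \<and> j < i} \<inter> {(i, j). i \<in> I \<and> j \<in> J \<and> i < j} = {}"
    by auto
  moreover have "finite {(i, j). i \<in> I \<and> j \<in> J \<and> i < j}"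
    using assms by (auto intro: finite_subset[of _ "I \<times> J"])
  ultimately have "card {(i, j). i \<in> I \<and> j \<in> J \<and> j < i} + card {(i, j). i \<in> I \<and> j \<in> J \<and> i < j}
      = card I * card J"
    using assms by (simp add: card_Un_disjoint[symmetric] finite_inversions card_cartesian_product[symmetric])
  then show ?thesis
    by (simp add: shuffle_sign_def swap flip: power_add)
qed

subsection \<open>Graded commutativity\<close>

text \<open>Signs depend on degrees only modulo 2. The index is an arbitrary natural number, so that
  degrees add under multiplication without reduction; the zero form has every parity.\<close>

definition has_parity :: "nat \<Rightarrow> ('i::linorder, 'a::comm_ring_1) exterior \<Rightarrow> bool" where
  "has_parity p a \<longleftrightarrow> (\<forall>I. ecoeff a I \<noteq> 0 \<longrightarrow> even (card I + p))"

lemma has_parity_0 [simp]: "has_parity p 0"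
  by (simp add: has_parity_def zero_exterior.rep_eq)

lemma has_parity_const [simp]: "has_parity 0 (ext_const c)"
  by (simp add: has_parity_def ext_const.rep_eq)

lemma has_parity_1 [simp]: "has_parity 0 1"
  by (simp add: has_parity_def one_exterior.rep_eq)

lemma has_parity_gen [simp]: "has_parity (Suc 0) (ext_gen i)"
  by (simp add: has_parity_def ext_gen.rep_eq)

lemma has_parity_add: "has_parity p a \<Longrightarrow> has_parity p b \<Longrightarrow> has_parity p (a + b)"
  unfolding has_parity_def plus_exterior.rep_eq by (metis add.right_neutral)

lemma has_parity_sum: "(\<And>i. i \<in> A \<Longrightarrow> has_parity p (f i)) \<Longrightarrow> has_parity p (sum f A)"
  by (induction A rule: infinite_finite_induct) (auto intro: has_parity_add)

lemma has_parity_mult: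
  assumes "has_parity p a" "has_parity q b"
  shows "has_parity (p + q) (a * b)"
  unfolding has_parity_def
proof safe
  fix K assume K: "ecoeff (a * b) K \<noteq> 0"
  then have fin: "finite K" using ecoeff[of "a * b"] by auto
  from K obtain I where I: "I \<in> Pow K"
      "shuffle_sign I (K - I) * ecoeff a I * ecoeff b (K - I) \<noteq> 0"
    unfolding ecoeff_mult by (rule sum.not_neutral_contains_not_neutral)
  from I(2) have "ecoeff a I \<noteq> 0" "ecoeff b (K - I) \<noteq> 0" by auto
  then have "even (card I + p)" "even (card (K - I) + q)"
    using assms by (auto simp: has_parity_def)
  moreover have "card K = card I + card (K - I)"
    using I fin by (simp add: card_Diff_subset card_mono finite_subset)
  ultimately show "even (card K + (p + q))" by simp
qed

text \<open>Substituting \<open>K - I\<close> for \<open>I\<close> exchanges the factors. It changes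
  the shuffle sign by \<open>(-1) ^ (card I * card (K - I))\<close>, which on nonzero summands is
  the constant \<open>(-1) ^ (p * q)\<close>.\<close>

lemma graded_commute:
  assumes "has_parity p a" "has_parity q b"
  shows "a * b = ext_const ((-1) ^ (p * q)) * (b * a)"
proof (rule exterior_eqI)
  fix K :: "'a set" assume K: "finite K"
  have "ecoeff (a * b) K
      = (\<Sum>I\<in>Pow K. (-1) ^ (p * q) * (shuffle_sign I (K - I) * ecoeff b I * ecoeff a (K - I)))"
    unfolding ecoeff_mult
  proof (rule sum.reindex_bij_witness[of _ "\<lambda>I. K - I" "\<lambda>I. K - I"], goal_cases)
    case (5 I)
    then have I: "I \<subseteq> K" "K - (K - I) = I" "finite I" "finite (K - I)"
      using K by (auto intro: finite_subset)
    show ?case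
    proof (cases "ecoeff a I = 0 \<or> ecoeff b (K - I) = 0")
      case False
      then have "even (card I + p)" "even (card (K - I) + q)"
        using assms by (auto simp: has_parity_def)
      then have "even (p * q) \<longleftrightarrow> even (card I * card (K - I))" by auto
      then have "(-1) ^ (p * q) = ((-1) ^ (card I * card (K - I)) :: 'b)"
        by (metis neg_one_even_power neg_one_odd_power)
      also have "\<dots> = shuffle_sign I (K - I) * shuffle_sign (K - I) I"
        using I by (subst shuffle_sign_swap) auto
      finally have sgn: "(-1) ^ (p * q) = (shuffle_sign I (K - I) * shuffle_sign (K - I) I :: 'b)" .
      have "(-1) ^ (p * q) * shuffle_sign (K - I) I = (shuffle_sign I (K - I) :: 'b)"
        unfolding sgn by (simp add: mult.assoc)
      then have "shuffle_sign I (K - I) * ecoeff a I * ecoeff b (K - I)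
          = ((-1) ^ (p * q) * shuffle_sign (K - I) I) * ecoeff a I * ecoeff b (K - I)" by simp
      then show ?thesis unfolding I by (simp only: mult_ac)
    qed (auto simp: I)
  qed auto
  then show "ecoeff (a * b) K = ecoeff (ext_const ((-1) ^ (p * q)) * (b * a)) K"
    unfolding ecoeff_const_mult[OF K] unfolding ecoeff_mult by (simp add: sum_distrib_left)
qed

subsection \<open>Contraction\<close>

text \<open>The interior product with the coordinate field dual to \<open>ext_gen e\<close>: the
  sign moves \<open>e\<close> to the front of the monomial, where it is removed.\<close>

lift_definition contract1 :: "'i::linorder \<Rightarrow> ('i, 'a::comm_ring_1) exterior \<Rightarrow> ('i, 'a) exterior"
  is "\<lambda>e f J. if e \<in> J then 0 else shuffle_sign {e} J * f (insert e J)"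
proof (rule conjI)
  fix e :: 'i and f :: "'i set \<Rightarrow> 'a"
  assume f: "finite {I. f I \<noteq> 0} \<and> (\<forall>I. infinite I \<longrightarrow> f I = 0)"
  have "{J. (if e \<in> J then 0 else shuffle_sign {e} J * f (insert e J)) \<noteq> 0}
      \<subseteq> (\<lambda>I. I - {e}) ` {I. f I \<noteq> 0}"
  proof
    fix J assume "J \<in> {J. (if e \<in> J then 0 else shuffle_sign {e} J * f (insert e J)) \<noteq> 0}"
    then have "e \<notin> J" "f (insert e J) \<noteq> 0" by (auto split: if_splits)
    then show "J \<in> (\<lambda>I. I - {e}) ` {I. f I \<noteq> 0}"
      by (intro image_eqI[of _ _ "insert e J"]) auto
  qed
  then show "finite {J. (if e \<in> J then 0 else shuffle_sign {e} J * f (insert e J)) \<noteq> 0}"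
    using f by (meson finite_imageI finite_subset)
  show "\<forall>J. infinite J \<longrightarrow> (if e \<in> J then 0 else shuffle_sign {e} J * f (insert e J)) = 0"
    using f by simp
qed

lemma sum_Pow_insert:
  assumes "finite J" "e \<notin> J"
  shows "(\<Sum>I\<in>Pow (insert e J). g I) = (\<Sum>I\<in>Pow J. g I) + (\<Sum>I\<in>Pow J. g (insert e I))"
proof -
  have "inj_on (insert e) (Pow J)" using assms by (auto simp: inj_on_def)
  moreover have "Pow J \<inter> insert e ` Pow J = {}" using assms by auto
  ultimately show ?thesis
    using assms by (simp add: Pow_insert sum.union_disjoint sum.reindex)
qed

text \<open>The interior product is an antiderivation. With \<open>J = K - {e}\<close>, the case
  \<open>e \<notin> K\<close> assigns the missing \<open>e\<close> to one of the two factors; in the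
  case \<open>e \<in> K\<close> the left side is 0 and the two terms on the right cancel.\<close>

lemma contract1_mult:
  fixes a b :: "('i::linorder, 'a::comm_ring_1) exterior"
  assumes "has_parity p a"
  shows "contract1 e (a * b) = contract1 e a * b + ext_const ((-1) ^ p) * (a * contract1 e b)"
proof (rule exterior_eqI)
  fix K :: "'i set" assume K: "finite K"
  define J where "J = K - {e}"
  have J: "finite J" "e \<notin> J" using K by (auto simp: J_def)
  have fin: "finite I" if "I \<in> Pow J" for I using that J by (auto intro: finite_subset)
  have ne: "e \<notin> I" if "I \<in> Pow J" for I using that J by auto
  have par: "(-1) ^ p * ecoeff a I = (-1) ^ card I * ecoeff a I" for I
  proof (cases "ecoeff a I = 0")
    case False
    then have "even p \<longleftrightarrow> even (card I)" using assms by (auto simp: has_parity_def)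
    then show ?thesis by (metis neg_one_even_power neg_one_odd_power)
  qed simp
  have swap: "shuffle_sign {e} I * shuffle_sign I {e} = ((-1) ^ card I :: 'a)" if "I \<in> Pow J" for I
    using shuffle_sign_swap[of "{e}" I] fin[OF that] ne[OF that] by simp
  \<comment> \<open>The subsets of \<open>insert e J\<close> are grouped by which of the two factors
    receives \<open>e\<close>.\<close>
  have inner: "ecoeff (x * y) (insert e J) =
      (\<Sum>I\<in>Pow J. shuffle_sign I (insert e (J - I)) * ecoeff x I * ecoeff y (insert e (J - I)))
      + (\<Sum>I\<in>Pow J. shuffle_sign (insert e I) (J - I) * ecoeff x (insert e I) * ecoeff y (J - I))"
    for x y :: "('i, 'a) exterior"
    unfolding ecoeff_mult sum_Pow_insert[OF J]
    by (intro arg_cong2[of _ _ _ _ "(+)"] sum.cong) (use J in \<open>auto simp: insert_Diff_if\<close>)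
  have insR: "shuffle_sign I (insert e (J - I)) = (shuffle_sign I (J - I) * shuffle_sign I {e} :: 'a)"
    if "I \<in> Pow J" for I
    using shuffle_sign_Un_right[of I "J - I" "{e}"] fin[OF that] ne[OF that] J by (simp add: Un_commute)
  have insL: "shuffle_sign (insert e I) (J - I) = (shuffle_sign {e} (J - I) * shuffle_sign I (J - I) :: 'a)"
    if "I \<in> Pow J" for I
    using shuffle_sign_Un_left[of "{e}" I "J - I"] fin[OF that] ne[OF that] J by simp
  have insJ: "shuffle_sign {e} J = (shuffle_sign {e} I * shuffle_sign {e} (J - I) :: 'a)"
    if "I \<in> Pow J" for I
    using shuffle_sign_Un_right[of "{e}" I "J - I"] fin[OF that] J that
    by (simp add: Un_absorb1)
  show "ecoeff (contract1 e (a * b)) K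
      = ecoeff (contract1 e a * b + ext_const ((-1) ^ p) * (a * contract1 e b)) K"
  proof (cases "e \<in> K")
    case False
    then have KJ: "K = J" by (auto simp: J_def)
    have "ecoeff (contract1 e (a * b)) K = shuffle_sign {e} J * ecoeff (a * b) (insert e J)"
      using J by (simp add: KJ contract1.rep_eq)
    also have "\<dots> =
      (\<Sum>I\<in>Pow J. shuffle_sign {e} J * (shuffle_sign I (insert e (J - I)) * ecoeff a I * ecoeff b (insert e (J - I))))
      + (\<Sum>I\<in>Pow J. shuffle_sign {e} J * (shuffle_sign (insert e I) (J - I) * ecoeff a (insert e I) * ecoeff b (J - I)))"
      by (simp add: inner distrib_left sum_distrib_left)
    also have "(\<Sum>I\<in>Pow J. shuffle_sign {e} J * (shuffle_sign (insert e I) (J - I) * ecoeff a (insert e I) * ecoeff b (J - I)))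
      = ecoeff (contract1 e a * b) K"
      unfolding ecoeff_mult KJ
    proof (rule sum.cong[OF refl])
      fix I assume I: "I \<in> Pow J"
      have "shuffle_sign {e} J * shuffle_sign (insert e I) (J - I)
          = shuffle_sign {e} I * shuffle_sign I (J - I) * (shuffle_sign {e} (J - I) * shuffle_sign {e} (J - I) :: 'a)"
        unfolding insJ[OF I] insL[OF I] by (simp only: mult_ac)
      then have "shuffle_sign {e} J * shuffle_sign (insert e I) (J - I)
          = (shuffle_sign {e} I * shuffle_sign I (J - I) :: 'a)" by simp
      then have "(shuffle_sign {e} J * shuffle_sign (insert e I) (J - I)) * (ecoeff a (insert e I) * ecoeff b (J - I))
        = shuffle_sign I (J - I) * ecoeff (contract1 e a) I * ecoeff b (J - I)"
        using ne[OF I] by (simp add: contract1.rep_eq mult_ac)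
      then show "shuffle_sign {e} J * (shuffle_sign (insert e I) (J - I) * ecoeff a (insert e I) * ecoeff b (J - I))
        = shuffle_sign I (J - I) * ecoeff (contract1 e a) I * ecoeff b (J - I)"
        by (simp only: mult.assoc)
    qed
    also have "(\<Sum>I\<in>Pow J. shuffle_sign {e} J * (shuffle_sign I (insert e (J - I)) * ecoeff a I * ecoeff b (insert e (J - I))))
      = ecoeff (ext_const ((-1) ^ p) * (a * contract1 e b)) K"
      unfolding ecoeff_const_mult[OF K] unfolding ecoeff_mult KJ sum_distrib_left
    proof (rule sum.cong[OF refl])
      fix I assume I: "I \<in> Pow J"
      have "shuffle_sign {e} J * (shuffle_sign I (insert e (J - I)) * ecoeff a I * ecoeff b (insert e (J - I)))
        = shuffle_sign {e} (J - I) * shuffle_sign I (J - I) *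
          (shuffle_sign {e} I * shuffle_sign I {e} * ecoeff a I) * ecoeff b (insert e (J - I))"
        unfolding insJ[OF I] insR[OF I] by (simp only: mult_ac)
      also have "\<dots> = (-1) ^ p * (shuffle_sign I (J - I) * ecoeff a I * ecoeff (contract1 e b) (J - I))"
        unfolding swap[OF I] par[symmetric] using J by (simp add: contract1.rep_eq mult_ac)
      finally show "shuffle_sign {e} J * (shuffle_sign I (insert e (J - I)) * ecoeff a I * ecoeff b (insert e (J - I)))
        = (-1) ^ p * (shuffle_sign I (J - I) * ecoeff a I * ecoeff (contract1 e b) (J - I))" .
    qed
    finally show ?thesis by (simp add: plus_exterior.rep_eq)
  next
    case True
    then have KJ: "K = insert e J" by (auto simp: J_def)
    have 1: "ecoeff (contract1 e a * b) K =
      (\<Sum>I\<in>Pow J. shuffle_sign I (insert e (J - I)) * ecoeff (contract1 e a) I * ecoeff b (insert e (J - I)))"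
      unfolding KJ inner by (simp add: contract1.rep_eq)
    have 2: "ecoeff (ext_const ((-1) ^ p) * (a * contract1 e b)) K =
      (\<Sum>I\<in>Pow J. (-1) ^ p * (shuffle_sign (insert e I) (J - I) * ecoeff a (insert e I) * ecoeff (contract1 e b) (J - I)))"
      unfolding ecoeff_const_mult[OF K] unfolding KJ inner by (simp add: contract1.rep_eq sum_distrib_left)
    have "shuffle_sign I (insert e (J - I)) * ecoeff (contract1 e a) I * ecoeff b (insert e (J - I))
        + (-1) ^ p * (shuffle_sign (insert e I) (J - I) * ecoeff a (insert e I) * ecoeff (contract1 e b) (J - I)) = 0"
      if I: "I \<in> Pow J" for I
    proof -
      have "shuffle_sign I (insert e (J - I)) * ecoeff (contract1 e a) I * ecoeff b (insert e (J - I))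
          = (shuffle_sign {e} I * shuffle_sign I {e}) * shuffle_sign I (J - I) * ecoeff a (insert e I) * ecoeff b (insert e (J - I))"
        unfolding insR[OF I] using ne[OF I] by (simp add: contract1.rep_eq mult_ac)
      also have "\<dots> = (-1) ^ card I * shuffle_sign I (J - I) * ecoeff a (insert e I) * ecoeff b (insert e (J - I))"
        unfolding swap[OF I] ..
      finally have l: "shuffle_sign I (insert e (J - I)) * ecoeff (contract1 e a) I * ecoeff b (insert e (J - I))
        = (-1) ^ card I * shuffle_sign I (J - I) * ecoeff a (insert e I) * ecoeff b (insert e (J - I))" .
      have "(-1) ^ p * (shuffle_sign (insert e I) (J - I) * ecoeff a (insert e I) * ecoeff (contract1 e b) (J - I))
          = (shuffle_sign {e} (J - I) * shuffle_sign {e} (J - I)) * shuffle_sign I (J - I) *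
            ((-1) ^ p * ecoeff a (insert e I)) * ecoeff b (insert e (J - I))"
        unfolding insL[OF I] using J by (simp add: contract1.rep_eq mult_ac)
      \<comment> \<open>The sign for \<open>a\<close> is taken at \<open>insert e I\<close>, one
        element larger than \<open>I\<close>; this makes the two terms opposite.\<close>
      also have "\<dots> = - ((-1) ^ card I * shuffle_sign I (J - I) * ecoeff a (insert e I) * ecoeff b (insert e (J - I)))"
        unfolding par shuffle_sign_square using fin[OF I] ne[OF I] by (simp add: mult_ac)
      finally show ?thesis unfolding l by simp
    qed
    then have "ecoeff (contract1 e a * b) K + ecoeff (ext_const ((-1) ^ p) * (a * contract1 e b)) K = 0"
      unfolding 1 2 sum.distrib[symmetric] by (intro sum.neutral) blast
    then show ?thesis using True by (simp add: plus_exterior.rep_eq contract1.rep_eq)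
  qed
qed

text \<open>Contraction with the vector field that has components \<open>v e\<close> in the
  directions \<open>e \<in> S\<close>. For \<open>v = x\<close> this is the Euler field of the
  coordinates in \<open>S\<close>.\<close>

definition contract :: "'i::linorder set \<Rightarrow> ('i \<Rightarrow> 'a::comm_ring_1) \<Rightarrow> ('i, 'a) exterior \<Rightarrow> ('i, 'a) exterior" where
  "contract S v a = (\<Sum>e\<in>S. ext_const (v e) * contract1 e a)"

lemma contract_mult:
  assumes "has_parity p a"
  shows "contract S v (a * b) = contract S v a * b + ext_const ((-1) ^ p) * (a * contract S v b)"
proof -
  have "ext_const (v e) * contract1 e (a * b)
      = (ext_const (v e) * contract1 e a) * b
        + ext_const ((-1) ^ p) * (a * (ext_const (v e) * contract1 e b))" for e
    unfolding contract1_mult[OF assms] distrib_left ext_const_left_commute[of a]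
      ext_const_left_commute[of "ext_const (v e)" "(-1) ^ p"] by (simp only: mult.assoc)
  then show ?thesis
    by (simp add: contract_def sum_distrib_left sum_distrib_right sum.distrib)
qed

lemma ecoeff_contract:
  "finite J \<Longrightarrow> ecoeff (contract S v a) J
    = (\<Sum>e\<in>S. if e \<in> J then 0 else v e * (shuffle_sign {e} J * ecoeff a (insert e J)))"
  unfolding contract_def ecoeff_sum
  by (rule sum.cong) (auto simp: ecoeff_const_mult contract1.rep_eq)

lemma contract_add: "contract S v (a + b) = contract S v a + contract S v b"
  by (rule exterior_eqI)
    (auto simp: ecoeff_contract plus_exterior.rep_eq algebra_simps simp flip: sum.distrib intro!: sum.cong)

lemma contract_zero [simp]: "contract S v 0 = 0"
  by (rule exterior_eqI) (simp add: ecoeff_contract zero_exterior.rep_eq cong: if_cong)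

lemma contract_sum: "contract S v (sum f A) = (\<Sum>i\<in>A. contract S v (f i))"
  by (induction A rule: infinite_finite_induct) (auto simp: contract_add)

lemma contract_const [simp]: "contract S v (ext_const c) = 0"
  by (rule exterior_eqI) (simp add: ecoeff_contract zero_exterior.rep_eq ext_const.rep_eq cong: if_cong)

lemma contract_one [simp]: "contract S v 1 = 0"
  using contract_const[of S v 1] by simp

lemma contract_gen:
  assumes "finite S"
  shows "contract S v (ext_gen i) = ext_const (if i \<in> S then v i else 0)"
proof (rule exterior_eqI)
  fix J :: "'a set" assume J: "finite J"
  have "ecoeff (contract S v (ext_gen i)) J = (\<Sum>e\<in>S. if e = i then (if J = {} then v i else 0) else 0)"
    unfolding ecoeff_contract[OF J] by (rule sum.cong) (auto simp: ext_gen.rep_eq)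
  then show "ecoeff (contract S v (ext_gen i)) J = ecoeff (ext_const (if i \<in> S then v i else 0)) J"
    using assms by (simp add: ext_const.rep_eq sum.delta)
qed

subsection \<open>A weighted norm\<close>

text \<open>The weights give every logarithmic differential \<open>dx\<^sub>e / x\<^sub>e\<close> norm 1.\<close>

definition wnorm :: "nat \<Rightarrow> (nat \<Rightarrow> real) \<Rightarrow> (nat, real) exterior \<Rightarrow> real" where
  "wnorm n x a = (\<Sum>I\<in>Pow {..<n}. \<bar>ecoeff a I\<bar> * (\<Prod>e\<in>I. x e))"

context
  fixes n :: nat and x :: "nat \<Rightarrow> real"
  assumes x: "\<And>e. e < n \<Longrightarrow> 0 < x e"
begin

lemma wnorm_weight_nonneg: "I \<subseteq> {..<n} \<Longrightarrow> 0 \<le> (\<Prod>e\<in>I. x e)"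
  using x by (intro prod_nonneg) (auto intro: less_imp_le)

lemma wnorm_nonneg: "0 \<le> wnorm n x a"
  unfolding wnorm_def by (intro sum_nonneg mult_nonneg_nonneg wnorm_weight_nonneg) auto

lemma coeff_le_wnorm: "I \<subseteq> {..<n} \<Longrightarrow> \<bar>ecoeff a I\<bar> * (\<Prod>e\<in>I. x e) \<le> wnorm n x a"
  unfolding wnorm_def
  by (rule member_le_sum) (auto intro!: mult_nonneg_nonneg wnorm_weight_nonneg)

lemma wnorm_add: "wnorm n x (a + b) \<le> wnorm n x a + wnorm n x b"
  unfolding wnorm_def sum.distrib[symmetric] plus_exterior.rep_eq
  by (intro sum_mono) (auto simp: distrib_right[symmetric] intro!: mult_right_mono wnorm_weight_nonneg)

lemma wnorm_zero [simp]: "wnorm n x 0 = 0"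
  by (simp add: wnorm_def zero_exterior.rep_eq)

lemma wnorm_sum: "wnorm n x (sum f A) \<le> (\<Sum>i\<in>A. wnorm n x (f i))"
proof (induction A rule: infinite_finite_induct)
  case (insert i A)
  then show ?case using wnorm_add[of "f i" "sum f A"] by simp
qed auto

lemma wnorm_const [simp]: "wnorm n x (ext_const c) = \<bar>c\<bar>"
proof -
  have "wnorm n x (ext_const c) = (\<Sum>I\<in>{{}::nat set}. \<bar>c\<bar>)"
    unfolding wnorm_def by (rule sum.mono_neutral_cong_right) (auto simp: ext_const.rep_eq)
  then show ?thesis by simp
qed

lemma wnorm_gen: "i < n \<Longrightarrow> wnorm n x (ext_gen i) = x i"
proof -
  assume i: "i < n"
  have "wnorm n x (ext_gen i) = (\<Sum>I\<in>{{i}}. x i)"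
    unfolding wnorm_def
    by (rule sum.mono_neutral_cong_right) (use i in \<open>auto simp: ext_gen.rep_eq\<close>)
  then show ?thesis by simp
qed

text \<open>Weights are multiplicative on disjoint unions. The product of the norms expands over all
  pairs \<open>(I, J)\<close>, while the left side involves only the disjoint ones, reached
  injectively from \<open>(K, I)\<close> by \<open>J = K - I\<close>.\<close>

lemma wnorm_mult: "wnorm n x (a * b) \<le> wnorm n x a * wnorm n x b"
proof -
  let ?w = "\<lambda>a I. \<bar>ecoeff a I\<bar> * (\<Prod>e\<in>I. x e)"
  have nn: "0 \<le> ?w c I" if "I \<subseteq> {..<n}" for c :: "(nat, real) exterior" and I
    using that by (simp add: wnorm_weight_nonneg)
  have "wnorm n x (a * b) \<le> (\<Sum>K\<in>Pow {..<n}. \<Sum>I\<in>Pow K. ?w a I * ?w b (K - I))"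
    unfolding wnorm_def
  proof (rule sum_mono)
    fix K assume "K \<in> Pow {..<n}"
    then have K: "K \<subseteq> {..<n}" "finite K" by (auto intro: finite_subset)
    have "\<bar>ecoeff (a * b) K\<bar> \<le> (\<Sum>I\<in>Pow K. \<bar>ecoeff a I\<bar> * \<bar>ecoeff b (K - I)\<bar>)"
      unfolding ecoeff_mult by (rule order_trans[OF sum_abs]) (simp add: abs_mult)
    then have "?w (a * b) K \<le> (\<Sum>I\<in>Pow K. \<bar>ecoeff a I\<bar> * \<bar>ecoeff b (K - I)\<bar>) * (\<Prod>e\<in>K. x e)"
      by (intro mult_right_mono wnorm_weight_nonneg K)
    also have "\<dots> = (\<Sum>I\<in>Pow K. ?w a I * ?w b (K - I))"
      unfolding sum_distrib_right
    proof (rule sum.cong[OF refl])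
      fix I assume "I \<in> Pow K"
      then have "(\<Prod>e\<in>K. x e) = (\<Prod>e\<in>I. x e) * (\<Prod>e\<in>K - I. x e)"
        using K(2) by (metis PowD mult.commute prod.subset_diff)
      then show "\<bar>ecoeff a I\<bar> * \<bar>ecoeff b (K - I)\<bar> * (\<Prod>e\<in>K. x e) = ?w a I * ?w b (K - I)"
        by (simp add: mult_ac)
    qed
    finally show "?w (a * b) K \<le> (\<Sum>I\<in>Pow K. ?w a I * ?w b (K - I))" .
  qed
  also have "\<dots> = (\<Sum>(K, I)\<in>Sigma (Pow {..<n}) Pow. ?w a I * ?w b (K - I))"
    by (rule sum.Sigma) (auto intro: finite_subset)
  also have "\<dots> = (\<Sum>(I, J)\<in>(\<lambda>(K, I). (I, K - I)) ` Sigma (Pow {..<n}) Pow. ?w a I * ?w b J)"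
    by (subst sum.reindex) (auto simp: inj_on_def case_prod_unfold)
  also have "\<dots> \<le> (\<Sum>(I, J)\<in>Pow {..<n} \<times> Pow {..<n}. ?w a I * ?w b J)"
    by (rule sum_mono2) (auto intro!: mult_nonneg_nonneg nn)
  also have "\<dots> = wnorm n x a * wnorm n x b"
    unfolding wnorm_def sum_product sum.cartesian_product ..
  finally show ?thesis .
qed

end


section \<open>Matrices of forms\<close>

lemma mult_mat_entry:
  assumes "A \<in> carrier_mat nr n" "B \<in> carrier_mat n nc" "i < nr" "j < nc"
  shows "(A * B) $$ (i, j) = (\<Sum>k<n. A $$ (i, k) * B $$ (k, j))"
  using assms by (auto simp: scalar_prod_def lessThan_atLeast0)

lemma pow_mat_add:
  assumes A: "A \<in> carrier_mat n n"
  shows "A ^\<^sub>m (a + b) = A ^\<^sub>m a * A ^\<^sub>m b"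
proof (induction b)
  case 0
  then show ?case using right_mult_one_mat[OF pow_carrier_mat[OF A, of a]] A by simp
next
  case (Suc b)
  then show ?case by (simp add: assoc_mult_mat[of _ n n _ n _ n] A)
qed

lemma smult_mult_mat:
  fixes A B :: "'a::semiring_0 mat"
  assumes "A \<in> carrier_mat nr n" "B \<in> carrier_mat n nc"
  shows "(c \<cdot>\<^sub>m A) * B = c \<cdot>\<^sub>m (A * B)"
proof (rule eq_matI)
  fix i j assume "i < dim_row (c \<cdot>\<^sub>m (A * B))" "j < dim_col (c \<cdot>\<^sub>m (A * B))"
  then have ij: "i < nr" "j < nc" using assms by auto
  have cA: "c \<cdot>\<^sub>m A \<in> carrier_mat nr n" using assms by simp
  show "((c \<cdot>\<^sub>m A) * B) $$ (i, j) = (c \<cdot>\<^sub>m (A * B)) $$ (i, j)"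
    using mult_mat_entry[OF cA assms(2) ij] mult_mat_entry[OF assms ij] ij assms
    by (simp add: sum_distrib_left mult.assoc del: index_mult_mat(1))
qed (use assms in auto)

lemma mat_trace_add:
  assumes "A \<in> carrier_mat n n" "B \<in> carrier_mat n n"
  shows "mat_trace (A + B) = mat_trace A + mat_trace B"
  using assms by (simp add: mat_trace_def sum.distrib)

lemma mat_trace_smult:
  fixes A :: "'a::semiring_0 mat"
  shows "A \<in> carrier_mat n n \<Longrightarrow> mat_trace (c \<cdot>\<^sub>m A) = c * mat_trace A"
  by (auto simp: mat_trace_def sum_distrib_left intro!: sum.cong)

section \<open>Parity of matrices and graded cyclicity of the trace\<close>

definition mat_parity :: "nat \<Rightarrow> ('i::linorder, 'a::comm_ring_1) exterior mat \<Rightarrow> bool" where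
  "mat_parity p A \<longleftrightarrow> (\<forall>i<dim_row A. \<forall>j<dim_col A. has_parity p (A $$ (i, j)))"

lemma mat_parity_mult:
  assumes "A \<in> carrier_mat nr n" "B \<in> carrier_mat n nc" "mat_parity p A" "mat_parity q B"
  shows "mat_parity (p + q) (A * B)"
proof -
  have "has_parity (p + q) ((A * B) $$ (i, j))" if "i < nr" "j < nc" for i j
    unfolding mult_mat_entry[OF assms(1,2) that]
    by (intro has_parity_sum has_parity_mult) (use assms that in \<open>auto simp: mat_parity_def\<close>)
  then show ?thesis using assms(1,2) by (auto simp: mat_parity_def)
qed

lemma mat_parity_pow:
  assumes "A \<in> carrier_mat n n" "mat_parity (Suc 0) A"
  shows "mat_parity m (A ^\<^sub>m m)"
proof (induction m)
  case 0
  then show ?case using assms by (auto simp: mat_parity_def)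
next
  case (Suc m)
  then show ?case
    using mat_parity_mult[OF pow_carrier_mat[OF assms(1)] assms(1) Suc assms(2)] by simp
qed

lemma mat_parity_trace:
  "A \<in> carrier_mat n n \<Longrightarrow> mat_parity p A \<Longrightarrow> has_parity p (mat_trace A)"
  unfolding mat_trace_def by (intro has_parity_sum) (auto simp: mat_parity_def)

text \<open>All pairs of entries commute up to one and the same sign, so exchanging the two
  summations works as over a commutative ring.\<close>

lemma mat_trace_graded_cyclic:
  assumes "A \<in> carrier_mat nr n" "B \<in> carrier_mat n nr" "mat_parity p A" "mat_parity q B"
  shows "mat_trace (A * B) = ext_const ((-1) ^ (p * q)) * mat_trace (B * A)"
proof -
  have "mat_trace (A * B) = (\<Sum>i<nr. \<Sum>k<n. A $$ (i, k) * B $$ (k, i))"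
    using assms by (auto simp: mat_trace_def mult_mat_entry[OF assms(1,2)] simp del: index_mult_mat(1))
  also have "\<dots> = (\<Sum>i<nr. \<Sum>k<n. ext_const ((-1) ^ (p * q)) * (B $$ (k, i) * A $$ (i, k)))"
    by (intro sum.cong refl graded_commute) (use assms in \<open>auto simp: mat_parity_def\<close>)
  also have "\<dots> = ext_const ((-1) ^ (p * q)) * (\<Sum>k<n. \<Sum>i<nr. B $$ (k, i) * A $$ (i, k))"
    by (subst sum.swap) (simp only: sum_distrib_left)
  also have "(\<Sum>k<n. \<Sum>i<nr. B $$ (k, i) * A $$ (i, k)) = mat_trace (B * A)"
    using assms by (auto simp: mat_trace_def mult_mat_entry[OF assms(2,1)] simp del: index_mult_mat(1))
  finally show ?thesis .
qed

lemma contract_trace: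
  assumes "A \<in> carrier_mat n n"
  shows "contract S v (mat_trace A) = mat_trace (map_mat (contract S v) A)"
  using assms by (simp add: mat_trace_def contract_sum)

lemma contract_mat_mult:
  assumes "A \<in> carrier_mat nr n" "B \<in> carrier_mat n nc" "mat_parity p A"
  shows "map_mat (contract S v) (A * B) = map_mat (contract S v) A * B
    + ext_const ((-1) ^ p) \<cdot>\<^sub>m (A * map_mat (contract S v) B)" (is "?l = ?r")
proof (rule eq_matI)
  have B': "map_mat (contract S v) B \<in> carrier_mat n nc"
    and A': "map_mat (contract S v) A \<in> carrier_mat nr n" using assms by auto
  fix i j assume "i < dim_row ?r" "j < dim_col ?r"
  then have ij: "i < nr" "j < nc" using assms by auto
  have "contract S v (A $$ (i, k) * B $$ (k, j)) = contract S v (A $$ (i, k)) * B $$ (k, j)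
      + ext_const ((-1) ^ p) * (A $$ (i, k) * contract S v (B $$ (k, j)))" if "k < n" for k
    by (rule contract_mult) (use assms ij that in \<open>auto simp: mat_parity_def\<close>)
  then have "contract S v ((A * B) $$ (i, j))
      = (\<Sum>k<n. contract S v (A $$ (i, k)) * B $$ (k, j))
        + ext_const ((-1) ^ p) * (\<Sum>k<n. A $$ (i, k) * contract S v (B $$ (k, j)))"
    unfolding mult_mat_entry[OF assms(1,2) ij]
    by (simp add: contract_sum sum.distrib sum_distrib_left)
  also have "\<dots> = ?r $$ (i, j)"
    using ij assms(1,2) mult_mat_entry[OF A' assms(2) ij] mult_mat_entry[OF assms(1) B' ij] by simp
  finally show "?l $$ (i, j) = ?r $$ (i, j)" using ij assms by simp
qed (use assms in auto)

section \<open>A submultiplicative norm on matrices of forms\<close>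

definition mnorm :: "nat \<Rightarrow> (nat \<Rightarrow> real) \<Rightarrow> (nat, real) exterior mat \<Rightarrow> real" where
  "mnorm n x A = (\<Sum>i<dim_row A. \<Sum>j<dim_col A. wnorm n x (A $$ (i, j)))"

context
  fixes n :: nat and x :: "nat \<Rightarrow> real"
  assumes x: "\<And>e. e < n \<Longrightarrow> 0 < x e"
begin

lemma wnorm_sign: "wnorm n x (ext_const ((-1) ^ p) * a) = wnorm n x a"
  unfolding wnorm_def
  by (intro sum.cong refl) (auto simp: ecoeff_const_mult abs_mult power_abs finite_subset)

lemma mnorm_nonneg: "0 \<le> mnorm n x A"
  unfolding mnorm_def by (intro sum_nonneg wnorm_nonneg x)

text \<open>Replacing the norm of \<open>B $$ (k, j)\<close> by the sum over column \<open>j\<close>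
  decouples the indices, and the triple sum factors.\<close>

lemma mnorm_mult:
  assumes "A \<in> carrier_mat nr m" "B \<in> carrier_mat m nc"
  shows "mnorm n x (A * B) \<le> mnorm n x A * mnorm n x B"
proof -
  let ?w = "wnorm n x"
  have nn: "0 \<le> ?w a" for a by (intro wnorm_nonneg x)
  have "mnorm n x (A * B) = (\<Sum>i<nr. \<Sum>j<nc. ?w (\<Sum>k<m. A $$ (i, k) * B $$ (k, j)))"
    using assms by (auto simp: mnorm_def mult_mat_entry[OF assms] simp del: index_mult_mat(1))
  also have "\<dots> \<le> (\<Sum>i<nr. \<Sum>j<nc. \<Sum>k<m. ?w (A $$ (i, k)) * ?w (B $$ (k, j)))"
    by (intro sum_mono order_trans[OF wnorm_sum] x wnorm_mult)
  also have "\<dots> \<le> (\<Sum>i<nr. \<Sum>j<nc. \<Sum>k<m. ?w (A $$ (i, k)) * (\<Sum>l<m. ?w (B $$ (l, j))))"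
    by (intro sum_mono mult_left_mono nn member_le_sum) auto
  also have "\<dots> = (\<Sum>i<nr. \<Sum>k<m. ?w (A $$ (i, k))) * (\<Sum>j<nc. \<Sum>l<m. ?w (B $$ (l, j)))"
    by (simp only: sum_distrib_left[symmetric] sum_distrib_right[symmetric])
  also have "(\<Sum>j<nc. \<Sum>l<m. ?w (B $$ (l, j))) = mnorm n x B"
    using assms by (subst sum.swap) (simp add: mnorm_def)
  finally show ?thesis using assms by (simp add: mnorm_def)
qed

lemma wnorm_trace_le_mnorm:
  assumes "A \<in> carrier_mat m m"
  shows "wnorm n x (mat_trace A) \<le> mnorm n x A"
proof -
  have "wnorm n x (mat_trace A) \<le> (\<Sum>i<m. wnorm n x (A $$ (i, i)))"
    using assms by (simp add: mat_trace_def wnorm_sum x)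
  also have "\<dots> \<le> (\<Sum>i<m. \<Sum>j<m. wnorm n x (A $$ (i, j)))"
    by (intro sum_mono member_le_sum) (auto intro: wnorm_nonneg x)
  finally show ?thesis using assms by (simp add: mnorm_def)
qed

lemma mnorm_const_le:
  assumes "A \<in> carrier_mat m m" "\<And>i j. i < m \<Longrightarrow> j < m \<Longrightarrow> \<bar>A $$ (i, j)\<bar> \<le> c"
  shows "mnorm n x (map_mat ext_const A) \<le> of_nat (m * m) * c"
proof -
  have "mnorm n x (map_mat ext_const A) = (\<Sum>i<m. \<Sum>j<m. \<bar>A $$ (i, j)\<bar>)"
    using assms(1) by (simp add: mnorm_def wnorm_const x)
  also have "\<dots> \<le> (\<Sum>i<m. \<Sum>j<m. c)"
    by (intro sum_mono assms(2)) auto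
  finally show ?thesis by simp
qed

text \<open>The factor \<open>m * m\<close> bounds the norm of the identity matrix, which is the
  case \<open>r = 0\<close>; each further factor costs one application of
  submultiplicativity.\<close>

lemma mnorm_pow:
  assumes "A \<in> carrier_mat m m"
  shows "mnorm n x (A ^\<^sub>m r) \<le> of_nat (m * m) * mnorm n x A ^ r"
proof (induction r)
  case 0
  have "mnorm n x (1\<^sub>m m) \<le> of_nat (m * m) * 1"
    using mnorm_const_le[of "1\<^sub>m m" m 1] by (simp add: ext_const.mat_hom_one)
  then show ?case using assms by simp
next
  case (Suc r)
  have "mnorm n x (A ^\<^sub>m Suc r) \<le> mnorm n x (A ^\<^sub>m r) * mnorm n x A"
    using assms by (simp add: mnorm_mult[of _ m m _ m] pow_carrier_mat)
  also have "\<dots> \<le> of_nat (m * m) * mnorm n x A ^ r * mnorm n x A"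
    by (intro mult_right_mono Suc mnorm_nonneg)
  finally show ?case by (simp add: mult_ac)
qed

end

subsection \<open>Traces of powers of a projection times the logarithmic differentials\<close>

definition dlog :: "nat \<Rightarrow> (nat \<Rightarrow> real) \<Rightarrow> (nat, real) exterior mat" where
  "dlog n x = mat_diag n (\<lambda>e. ext_const (1 / x e) * ext_gen e)"

definition dlog_proj :: "nat \<Rightarrow> (nat \<Rightarrow> real) \<Rightarrow> real mat \<Rightarrow> (nat, real) exterior mat" where
  "dlog_proj n x Q = dlog n x * map_mat ext_const Q"

lemma dlog_carrier [simp]: "dlog n x \<in> carrier_mat n n"
  by (simp add: dlog_def mat_diag_def)

lemma dlog_proj_carrier [simp]: "Q \<in> carrier_mat n n \<Longrightarrow> dlog_proj n x Q \<in> carrier_mat n n"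
  by (simp add: dlog_proj_def mult_carrier_mat[of _ n n])

lemma mat_parity_dlog: "mat_parity (Suc 0) (dlog n x)"
  using has_parity_mult[OF has_parity_const has_parity_gen]
  by (auto simp: mat_parity_def dlog_def mat_diag_def)

lemma mat_parity_const: "mat_parity 0 (map_mat ext_const A)"
  by (simp add: mat_parity_def)

lemma mat_parity_dlog_proj:
  assumes "Q \<in> carrier_mat n n"
  shows "mat_parity (Suc 0) (dlog_proj n x Q)"
  using mat_parity_mult[OF dlog_carrier _ mat_parity_dlog mat_parity_const[of Q], of n] assms
  by (simp add: dlog_proj_def)

context
  fixes n :: nat and x :: "nat \<Rightarrow> real" and Q :: "real mat" and q :: real
  assumes x: "\<And>e. e < n \<Longrightarrow> 0 < x e"
    and Q: "Q \<in> carrier_mat n n"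
    and Qq: "\<And>i j. i < n \<Longrightarrow> j < n \<Longrightarrow> \<bar>Q $$ (i, j)\<bar> \<le> q"
    and q: "0 \<le> q"
begin

lemma mnorm_dlog: "mnorm n x (dlog n x) \<le> of_nat n"
proof -
  have "mnorm n x (dlog n x)
      = (\<Sum>i<n. \<Sum>j<n. if i = j then wnorm n x (ext_const (1 / x i) * ext_gen i) else 0)"
    unfolding mnorm_def by (intro sum.cong) (auto simp: dlog_def mat_diag_def wnorm_zero x)
  also have "\<dots> = (\<Sum>i<n. wnorm n x (ext_const (1 / x i) * ext_gen i))"
    by simp
  also have "\<dots> \<le> (\<Sum>i<n. 1)"
  proof (rule sum_mono)
    fix i assume "i \<in> {..<n}"
    then have i: "i < n" by simp
    have "wnorm n x (ext_const (1 / x i) * ext_gen i) \<le> \<bar>1 / x i\<bar> * x i"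
      using wnorm_mult[of n x "ext_const (1 / x i)" "ext_gen i"] i
      by (simp add: wnorm_const wnorm_gen x)
    then show "wnorm n x (ext_const (1 / x i) * ext_gen i) \<le> 1" using x[OF i] by simp
  qed
  finally show ?thesis by simp
qed

lemma mnorm_dlog_proj: "mnorm n x (dlog_proj n x Q) \<le> of_nat n * (of_nat (n * n) * q)"
proof -
  have "mnorm n x (dlog_proj n x Q) \<le> mnorm n x (dlog n x) * mnorm n x (map_mat ext_const Q)"
    unfolding dlog_proj_def by (rule mnorm_mult[of _ _ _ n n _ n]) (use x Q in auto)
  also have "\<dots> \<le> of_nat n * (of_nat (n * n) * q)"
    by (intro mult_mono mnorm_dlog mnorm_const_le[OF x Q Qq] mnorm_nonneg x) auto
  finally show ?thesis .
qed

lemma mnorm_dlog_proj_pow: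
  "mnorm n x (dlog_proj n x Q ^\<^sub>m r) \<le> of_nat (n * n) * (of_nat n * (of_nat (n * n) * q)) ^ r"
proof -
  have "mnorm n x (dlog_proj n x Q ^\<^sub>m r) \<le> of_nat (n * n) * mnorm n x (dlog_proj n x Q) ^ r"
    by (rule mnorm_pow[OF x dlog_proj_carrier[OF Q]])
  also have "\<dots> \<le> of_nat (n * n) * (of_nat n * (of_nat (n * n) * q)) ^ r"
    by (intro mult_left_mono power_mono mnorm_dlog_proj mnorm_nonneg x) auto
  finally show ?thesis .
qed

lemma wnorm_trace_dlog_proj_pow:
  "wnorm n x (mat_trace (dlog_proj n x Q ^\<^sub>m r)) \<le> of_nat (n * n) * (of_nat n * (of_nat (n * n) * q)) ^ r"
  by (rule order_trans[OF wnorm_trace_le_mnorm[OF x pow_carrier_mat[OF dlog_proj_carrier[OF Q]]]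
        mnorm_dlog_proj_pow])

context
  fixes S :: "nat set" and c :: real
  assumes S: "S \<subseteq> {..<n}"
    and QQ: "Q * Q = Q"
    and Qc: "\<And>i j. i < n \<Longrightarrow> j < n \<Longrightarrow> i \<in> S \<longleftrightarrow> j \<notin> S \<Longrightarrow> \<bar>Q $$ (i, j)\<bar> \<le> c"
    and c: "0 \<le> c"
begin

text \<open>The Euler field of \<open>S\<close> pairs to 1 with
  \<open>dx\<^sub>e / x\<^sub>e\<close> for \<open>e \<in> S\<close> and to 0 otherwise. Contraction
  thus turns the diagonal of logarithmic differentials into the coordinate projection onto
  \<open>S\<close>.\<close>

lemma contract_dlog_proj:
  "map_mat (contract S x) (dlog_proj n x Q)
    = mat_diag n (\<lambda>i. if i \<in> S then 1 else 0) * map_mat ext_const Q"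
proof -
  have fS: "finite S" using S by (rule finite_subset) simp
  have mQ: "map_mat ext_const Q \<in> carrier_mat n n" using Q by simp
  have "contract S x (ext_const (1 / x i) * ext_gen i * ext_const (Q $$ (i, j)))
      = (if i \<in> S then 1 else 0) * ext_const (Q $$ (i, j))" if "i < n" for i j
    using x[OF that]
    by (simp add: mult.assoc contract_mult[of 0] contract_mult[of "Suc 0"] contract_gen[OF fS]
        ext_const.hom_mult[symmetric] del: ext_const.hom_mult)
  then show ?thesis
    unfolding dlog_proj_def dlog_def mat_diag_mult_left[OF mQ]
    by (intro eq_matI) (use Q in auto)
qed

text \<open>Modulo the commutator \<open>E\<close> of \<open>Q\<close> with the coordinate projection \<open>P\<close>, moving \<open>P\<close> once around
  the trace of an even power reproduces that trace with the opposite sign.\<close>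

lemma wnorm_trace_even_pow:
  assumes r: "even r" "r > 0"
  shows "wnorm n x (mat_trace (dlog_proj n x Q ^\<^sub>m r *
      (mat_diag n (\<lambda>i. if i \<in> S then 1 else 0) * map_mat ext_const Q)))
    \<le> of_nat (n * n) * (of_nat n * (of_nat (n * n) * q)) ^ (r - 1) * of_nat n
        * (of_nat (n * n) * c) * (1 + of_nat (n * n) * q)"
proof -
  define T where "T = dlog_proj n x Q"
  define D where "D = dlog n x"
  define P :: "(nat, real) exterior mat" where "P = mat_diag n (\<lambda>i. if i \<in> S then 1 else 0)"
  define Q' :: "(nat, real) exterior mat" where "Q' = map_mat ext_const Q"
  \<comment> \<open>The commutator \<open>Q P - P Q\<close>. Its nonzero entries lie between
    \<open>S\<close> and its complement, where \<open>c\<close> bounds them.\<close>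
  define E0 where "E0 = mat n n (\<lambda>(i, j). ((if j \<in> S then 1 else 0) - (if i \<in> S then 1 else 0)) * Q $$ (i, j))"
  define E :: "(nat, real) exterior mat" where "E = map_mat ext_const E0"
  \<comment> \<open>One factor is split off the even power, which leaves the odd power
    \<open>Z\<close>.\<close>
  define Z where "Z = T ^\<^sub>m (r - 1)"
  have T: "T = D * Q'" by (simp add: T_def D_def Q'_def dlog_proj_def)
  have cT: "T \<in> carrier_mat n n" by (simp add: T_def Q)
  have [simp]: "D \<in> carrier_mat n n" "P \<in> carrier_mat n n" "Q' \<in> carrier_mat n n"
      "E0 \<in> carrier_mat n n" "E \<in> carrier_mat n n" "Z \<in> carrier_mat n n"
    using Q cT by (auto simp: D_def P_def Q'_def E0_def E_def Z_def mat_diag_def pow_carrier_mat)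
  have [simp]: "A * B \<in> carrier_mat n n" if "A \<in> carrier_mat n n" "B \<in> carrier_mat n n"
    for A B :: "(nat, real) exterior mat" using that by simp
  note assoc = assoc_mult_mat[of _ n n _ n _ n]
  have DP: "D * P = P * D"
    unfolding D_def dlog_def P_def mat_diag_diag by (rule arg_cong[of _ _ "mat_diag n"]) auto
  have QP: "Q' * P = P * Q' + E"
  proof -
    have mQ: "map_mat ext_const Q \<in> carrier_mat n n" using Q by simp
    have "ext_const (Q $$ (i, j)) * (if j \<in> S then 1 else 0) =
        (if i \<in> S then 1 else 0) * ext_const (Q $$ (i, j)) +
        (ext_const (((if j \<in> S then 1 else 0) - (if i \<in> S then 1 else 0)) * Q $$ (i, j)) :: (nat, real) exterior)"
      for i j by (simp add: ext_const.hom_uminus)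
    then show ?thesis
      unfolding P_def Q'_def E_def E0_def mat_diag_mult_left[OF mQ] mat_diag_mult_right[OF mQ]
      by (intro eq_matI) (use Q in auto)
  qed
  have QQ': "Q' * Q' = Q'"
    unfolding Q'_def using QQ Q by (simp add: ext_const.mat_hom_mult[symmetric])
  have TZ: "T * Z = Z * T"
    using pow_mat_add[OF cT, of 1 "r - 1"] pow_mat_add[OF cT, of "r - 1" 1] left_mult_one_mat[OF cT] cT
    by (simp add: Z_def)
  have Tr: "T ^\<^sub>m r = Z * T"
    using r by (metis Z_def pow_mat.simps(2) Suc_pred')
  have parT: "mat_parity (Suc 0) T"
    unfolding T_def by (rule mat_parity_dlog_proj[OF Q])
  have parZ: "mat_parity (r - 1) Z"
    unfolding Z_def by (rule mat_parity_pow[OF cT parT])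
  have parP: "mat_parity 0 P" by (auto simp: mat_parity_def P_def mat_diag_def)
  have parZP: "mat_parity (r - 1) (Z * P)"
    using mat_parity_mult[of Z n n P n, OF _ _ parZ parP] by simp
  \<comment> \<open>Both \<open>Z * P\<close> and \<open>T\<close> are odd, so moving one past the
    other under the trace costs a minus sign. This is where the evenness of \<open>r\<close>
    enters.\<close>
  have odd: "odd ((r - 1) * Suc 0)" using r by auto
  \<comment> \<open>The trace that remains when the commutator is dropped; cycling shows that it
    equals its own negative up to a term containing \<open>E\<close>.\<close>
  define t where "t = mat_trace (Z * D * P * Q')"
  have "mat_trace (T ^\<^sub>m r * (P * Q')) = mat_trace (Z * D * (Q' * P) * Q')"
    unfolding Tr unfolding T by (simp add: assoc)
  also have "\<dots> = mat_trace (Z * D * P * (Q' * Q') + Z * D * E * Q')"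
    unfolding QP by (simp add: assoc mult_add_distrib_mat[of _ n n _ n] add_mult_distrib_mat[of _ n n _ _ n])
  also have "\<dots> = t + mat_trace (Z * D * E * Q')"
    unfolding QQ' t_def by (rule mat_trace_add[of _ n]) auto
  finally have 1: "mat_trace (T ^\<^sub>m r * (P * Q')) = t + mat_trace (Z * D * E * Q')" .
  have "t = mat_trace (Z * P * T)"
    unfolding t_def T by (simp add: assoc DP[symmetric]) (simp add: assoc[symmetric] DP)
  also have "\<dots> = ext_const ((-1) ^ ((r - 1) * Suc 0)) * mat_trace (T * (Z * P))"
    by (rule mat_trace_graded_cyclic[of "Z * P" n n T, OF _ _ parZP parT]) (use cT in auto)
  also have "\<dots> = - mat_trace (T * Z * P)"
    using odd by (simp add: ext_const.hom_uminus assoc cT)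
  also have "T * Z * P = Z * D * (Q' * P)"
    unfolding TZ by (simp add: T assoc)
  also have "\<dots> = Z * D * P * Q' + Z * D * E"
    unfolding QP by (simp add: assoc mult_add_distrib_mat[of _ n n _ n])
  also have "mat_trace (Z * D * P * Q' + Z * D * E) = t + mat_trace (Z * D * E)"
    unfolding t_def by (rule mat_trace_add[of _ n]) auto
  finally have 2: "t + t = - mat_trace (Z * D * E)" by (simp add: algebra_simps eq_neg_iff_add_eq_0)
  let ?zde = "mnorm n x Z * mnorm n x D * mnorm n x E"
  have ZDE: "mnorm n x (Z * D * E) \<le> ?zde"
    by (intro order_trans[OF mnorm_mult[of _ _ _ n n _ n]] mult_mono x mnorm_nonneg order_refl
        mult_nonneg_nonneg mnorm_mult[of _ _ _ n n _ n]) auto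
  have ZDEQ: "mnorm n x (Z * D * E * Q') \<le> ?zde * mnorm n x Q'"
    by (intro order_trans[OF mnorm_mult[of _ _ _ n n _ n]] mult_mono x mnorm_nonneg order_refl
        mult_nonneg_nonneg ZDE) auto
  \<comment> \<open>Passing to \<open>t + t\<close> can only enlarge the norm, which avoids a
    division by 2 among forms.\<close>
  have "wnorm n x t \<le> wnorm n x (t + t)"
    unfolding wnorm_def plus_exterior.rep_eq
    by (intro sum_mono mult_right_mono wnorm_weight_nonneg x) auto
  also have "\<dots> = wnorm n x (mat_trace (Z * D * E))"
    unfolding 2 by (simp add: wnorm_def uminus_exterior.rep_eq)
  also have "\<dots> \<le> ?zde"
    by (rule order_trans[OF wnorm_trace_le_mnorm[of _ _ _ n] ZDE]) (use x in auto)
  finally have t: "wnorm n x t \<le> ?zde" .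
  have "wnorm n x (mat_trace (T ^\<^sub>m r * (P * Q'))) \<le> wnorm n x t + wnorm n x (mat_trace (Z * D * E * Q'))"
    unfolding 1 by (rule wnorm_add) (rule x)
  also have "wnorm n x (mat_trace (Z * D * E * Q')) \<le> ?zde * mnorm n x Q'"
    by (rule order_trans[OF wnorm_trace_le_mnorm[of _ _ _ n] ZDEQ]) (use x in auto)
  finally have "wnorm n x (mat_trace (T ^\<^sub>m r * (P * Q'))) \<le> ?zde * (1 + mnorm n x Q')"
    using t by (simp add: algebra_simps)
  also have "\<dots> \<le> of_nat (n * n) * (of_nat n * (of_nat (n * n) * q)) ^ (r - 1) * of_nat n
        * (of_nat (n * n) * c) * (1 + of_nat (n * n) * q)"
  proof -
    have E: "mnorm n x E \<le> of_nat (n * n) * c"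
      unfolding E_def by (rule mnorm_const_le) (use x c Qc in \<open>auto simp: E0_def\<close>)
    have Qn: "mnorm n x Q' \<le> of_nat (n * n) * q"
      unfolding Q'_def by (rule mnorm_const_le[OF x Q Qq])
    have Zn: "mnorm n x Z \<le> of_nat (n * n) * (of_nat n * (of_nat (n * n) * q)) ^ (r - 1)"
      unfolding Z_def T_def by (rule mnorm_dlog_proj_pow)
    have Dn: "mnorm n x D \<le> of_nat n" unfolding D_def by (rule mnorm_dlog)
    show ?thesis
      by (intro mult_mono Zn Dn E add_mono order_refl Qn mult_nonneg_nonneg mnorm_nonneg x
          zero_le_power add_nonneg_nonneg) (use q c in auto)
  qed
  finally show ?thesis by (simp add: T_def P_def Q'_def)
qed

text \<open>The Leibniz rule yields \<open>m\<close> terms, each with one factor replaced by its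
  contraction \<open>U\<close>. Graded cyclicity brings such a term, up to sign, to the trace of the
  even power \<open>m - 1\<close> times \<open>U\<close>, to which the preceding estimate
  applies.\<close>

lemma wnorm_contract_trace_odd_pow:
  assumes m: "odd m" "m > 1"
  shows "wnorm n x (contract S x (mat_trace (dlog_proj n x Q ^\<^sub>m m)))
    \<le> of_nat m * (of_nat (n * n) * (of_nat n * (of_nat (n * n) * q)) ^ (m - 2) * of_nat n
        * (of_nat (n * n) * c) * (1 + of_nat (n * n) * q))" (is "_ \<le> _ * ?K")
proof -
  define T where "T = dlog_proj n x Q"
  define U where "U = map_mat (contract S x) T"
  have cT [simp]: "T \<in> carrier_mat n n" by (simp add: T_def Q)
  have cU [simp]: "U \<in> carrier_mat n n" by (simp add: U_def)
  have cTp [simp]: "T ^\<^sub>m a \<in> carrier_mat n n" for a by (simp add: pow_carrier_mat)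
  have [simp]: "A * B \<in> carrier_mat n n" if "A \<in> carrier_mat n n" "B \<in> carrier_mat n n"
    for A B :: "(nat, real) exterior mat" using that by simp
  note assoc = assoc_mult_mat[of _ n n _ n _ n]
  have parT: "mat_parity a (T ^\<^sub>m a)" for a
    by (rule mat_parity_pow[OF cT]) (simp add: T_def mat_parity_dlog_proj[OF Q])
  have U: "U = mat_diag n (\<lambda>i. if i \<in> S then 1 else 0) * map_mat ext_const Q"
    unfolding U_def T_def by (rule contract_dlog_proj)
  have parU: "mat_parity 0 U"
    unfolding U by (rule mat_parity_mult[of _ n n _ n 0 0, simplified])
      (use Q in \<open>auto simp: mat_parity_def mat_diag_def\<close>)
  have TU: "wnorm n x (mat_trace (T ^\<^sub>m a * U * T ^\<^sub>m b)) \<le> ?K" if "a + b + 1 = m" for a b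
  proof -
    have "mat_trace (T ^\<^sub>m a * U * T ^\<^sub>m b) = ext_const ((-1) ^ (a * b)) * mat_trace (T ^\<^sub>m b * (T ^\<^sub>m a * U))"
      by (rule mat_trace_graded_cyclic[of _ n n])
        (use mat_parity_mult[of "T ^\<^sub>m a" n n U n a 0, OF _ _ parT parU] parT in auto)
    then have "wnorm n x (mat_trace (T ^\<^sub>m a * U * T ^\<^sub>m b)) = wnorm n x (mat_trace (T ^\<^sub>m (b + a) * U))"
      by (simp add: wnorm_sign x assoc[symmetric] pow_mat_add[OF cT])
    moreover have "b + a = m - 1" "m - 2 = b + a - 1" using that m by auto
    ultimately show ?thesis
      using wnorm_trace_even_pow[of "b + a"] m unfolding U T_def by simp
  qed
  \<comment> \<open>The trailing power of \<open>T\<close> generalises the claim for the induction: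
    it absorbs the factor that each Leibniz step splits off.\<close>
  have "wnorm n x (mat_trace (map_mat (contract S x) (T ^\<^sub>m a) * T ^\<^sub>m b)) \<le> of_nat a * ?K"
    if "a + b = m" for a b
    using that
  proof (induction a arbitrary: b)
    case 0
    have "map_mat (contract S x) (T ^\<^sub>m 0) = 0\<^sub>m n n"
      by (intro eq_matI) (auto simp: T_def dlog_proj_def dlog_def mat_diag_def)
    then have "map_mat (contract S x) (T ^\<^sub>m 0) * T ^\<^sub>m b = 0\<^sub>m n n"
      using left_mult_zero_mat[OF cTp] by simp
    then show ?case by (simp add: mat_trace_def wnorm_zero x)
  next
    case (Suc a)
    have "map_mat (contract S x) (T ^\<^sub>m Suc a)
        = map_mat (contract S x) (T ^\<^sub>m a) * T + ext_const ((-1) ^ a) \<cdot>\<^sub>m (T ^\<^sub>m a * U)"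
      using contract_mat_mult[OF cTp cT parT, of S x] by (simp add: U_def)
    then have "map_mat (contract S x) (T ^\<^sub>m Suc a) * T ^\<^sub>m b
        = map_mat (contract S x) (T ^\<^sub>m a) * T ^\<^sub>m Suc b + ext_const ((-1) ^ a) \<cdot>\<^sub>m (T ^\<^sub>m a * U * T ^\<^sub>m b)"
      using pow_mat_add[OF cT, of 1 b] left_mult_one_mat[OF cT] carrier_matD(1)[OF cT]
      by (simp add: add_mult_distrib_mat[of _ n n _ _ n] assoc[of "map_mat _ _"] smult_carrier_mat
          smult_mult_mat[of _ n n _ n])
    moreover have "mat_trace (ext_const ((-1) ^ a) \<cdot>\<^sub>m (T ^\<^sub>m a * U * T ^\<^sub>m b))
        = ext_const ((-1) ^ a) * mat_trace (T ^\<^sub>m a * U * T ^\<^sub>m b)"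
      by (rule mat_trace_smult[of _ n]) simp
    ultimately have "mat_trace (map_mat (contract S x) (T ^\<^sub>m Suc a) * T ^\<^sub>m b)
        = mat_trace (map_mat (contract S x) (T ^\<^sub>m a) * T ^\<^sub>m Suc b)
          + ext_const ((-1) ^ a) * mat_trace (T ^\<^sub>m a * U * T ^\<^sub>m b)"
      by (simp add: mat_trace_add[of _ n] del: pow_mat.simps)
    then have "wnorm n x (mat_trace (map_mat (contract S x) (T ^\<^sub>m Suc a) * T ^\<^sub>m b))
        \<le> wnorm n x (mat_trace (map_mat (contract S x) (T ^\<^sub>m a) * T ^\<^sub>m Suc b))
          + wnorm n x (mat_trace (T ^\<^sub>m a * U * T ^\<^sub>m b))"
      using wnorm_add[of n x "mat_trace (map_mat (contract S x) (T ^\<^sub>m a) * T ^\<^sub>m Suc b)"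
          "ext_const ((-1) ^ a) * mat_trace (T ^\<^sub>m a * U * T ^\<^sub>m b)"]
      by (simp only: wnorm_sign[OF x] x)
    also have "\<dots> \<le> of_nat a * ?K + ?K"
      by (intro add_mono Suc.IH TU) (use Suc.prems in auto)
    finally show ?case by (simp add: algebra_simps)
  qed
  note this[of m 0]
  moreover have "map_mat (contract S x) (T ^\<^sub>m m) * T ^\<^sub>m 0 = map_mat (contract S x) (T ^\<^sub>m m)"
    using right_mult_one_mat[of "map_mat (contract S x) (T ^\<^sub>m m)" n n] carrier_matD(1)[OF cT] by simp
  ultimately show ?thesis
    by (simp only: contract_trace[OF cTp] T_def[symmetric] add_0_right)
qed

end

end


section \<open>Families of forms that are small after contraction\<close>

text \<open>A point \<open>(x, S, c)\<close> of \<open>A\<close> consists of coordinates, a set of edges on one side of a cut, and a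
  measure \<open>c\<close> of how far the two sides are from each other.\<close>

definition tame :: "nat \<Rightarrow> ((nat \<Rightarrow> real) \<times> nat set \<times> real) set \<Rightarrow> form \<Rightarrow> bool" where
  "tame n A f \<longleftrightarrow> (\<exists>C\<ge>0. \<forall>(x, S, c)\<in>A.
     wnorm n x (f x) \<le> C \<and> wnorm n x (contract S x (f x)) \<le> C * c)"

context
  fixes n :: nat and A :: "((nat \<Rightarrow> real) \<times> nat set \<times> real) set"
  assumes pos: "\<And>x S c e. (x, S, c) \<in> A \<Longrightarrow> e < n \<Longrightarrow> 0 < x e"
    and c_nonneg: "\<And>x S c. (x, S, c) \<in> A \<Longrightarrow> 0 \<le> c"
begin

lemma tame_const: "tame n A (\<lambda>_. ext_const a)"
  unfolding tame_def
  by (rule exI[of _ "\<bar>a\<bar>"]) (use pos c_nonneg in \<open>auto simp: wnorm_const wnorm_zero\<close>)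

lemma tame_add:
  assumes "tame n A f" "tame n A g"
  shows "tame n A (\<lambda>x. f x + g x)"
proof -
  from assms obtain B C where "0 \<le> B" "0 \<le> C"
    and B: "\<And>x S c. (x, S, c) \<in> A \<Longrightarrow> wnorm n x (f x) \<le> B \<and> wnorm n x (contract S x (f x)) \<le> B * c"
    and C: "\<And>x S c. (x, S, c) \<in> A \<Longrightarrow> wnorm n x (g x) \<le> C \<and> wnorm n x (contract S x (g x)) \<le> C * c"
    unfolding tame_def by blast
  have "wnorm n x (f x + g x) \<le> B + C \<and> wnorm n x (contract S x (f x + g x)) \<le> (B + C) * c"
    if "(x, S, c) \<in> A" for x S c
    using B[OF that] C[OF that] wnorm_add[of n x "f x" "g x"]
      wnorm_add[of n x "contract S x (f x)" "contract S x (g x)"] pos[OF that]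
    by (simp add: contract_add distrib_right)
  with \<open>0 \<le> B\<close> \<open>0 \<le> C\<close> show ?thesis
    unfolding tame_def by (intro exI[of _ "B + C"]) auto
qed

lemma tame_sum:
  assumes "\<And>i. i \<in> I \<Longrightarrow> tame n A (f i)"
  shows "tame n A (\<lambda>x. \<Sum>i\<in>I. f i x)"
  using assms
proof (induction I rule: infinite_finite_induct)
  case (insert i I)
  then show ?case by (simp add: tame_add)
qed (use tame_const[of 0] in auto)

text \<open>In each of the two Leibniz terms exactly one factor is contracted and contributes
  \<open>c\<close>; the 2 in the constant counts these terms. The parity of \<open>f\<close>
  determines the sign between them.\<close>

lemma tame_mult:
  assumes "tame n A f" "tame n A g" and p: "\<And>x S c. (x, S, c) \<in> A \<Longrightarrow> has_parity p (f x)"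
  shows "tame n A (\<lambda>x. f x * g x)"
proof -
  from assms(1,2) obtain B C where BC: "0 \<le> B" "0 \<le> C"
    and B: "\<And>x S c. (x, S, c) \<in> A \<Longrightarrow> wnorm n x (f x) \<le> B \<and> wnorm n x (contract S x (f x)) \<le> B * c"
    and C: "\<And>x S c. (x, S, c) \<in> A \<Longrightarrow> wnorm n x (g x) \<le> C \<and> wnorm n x (contract S x (g x)) \<le> C * c"
    unfolding tame_def by blast
  have "wnorm n x (f x * g x) \<le> 2 * B * C \<and> wnorm n x (contract S x (f x * g x)) \<le> 2 * B * C * c"
    if A: "(x, S, c) \<in> A" for x S c
  proof
    note x = pos[OF A] and c = c_nonneg[OF A]
    have nn: "0 \<le> wnorm n x a" for a by (rule wnorm_nonneg) (rule x)
    have mult: "wnorm n x (a * b) \<le> wnorm n x a * wnorm n x b" for a b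
      by (rule wnorm_mult) (rule x)
    have "wnorm n x (f x * g x) \<le> B * C"
      by (rule order_trans[OF mult mult_mono]) (use B[OF A] C[OF A] BC nn in auto)
    moreover have "0 \<le> B * C" using BC by simp
    ultimately show "wnorm n x (f x * g x) \<le> 2 * B * C" by simp
    have "wnorm n x (contract S x (f x) * g x) \<le> (B * c) * C"
      by (rule order_trans[OF mult mult_mono]) (use B[OF A] C[OF A] BC c nn in auto)
    moreover have "wnorm n x (f x * contract S x (g x)) \<le> B * (C * c)"
      by (rule order_trans[OF mult mult_mono]) (use B[OF A] C[OF A] BC c nn in auto)
    moreover have "wnorm n x (contract S x (f x * g x))
        \<le> wnorm n x (contract S x (f x) * g x) + wnorm n x (f x * contract S x (g x))"
      unfolding contract_mult[OF p[OF A]]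
      using wnorm_add[of n x "contract S x (f x) * g x"
          "ext_const ((-1) ^ p) * (f x * contract S x (g x))"]
      by (simp add: wnorm_sign[of n x] x)
    ultimately show "wnorm n x (contract S x (f x * g x)) \<le> 2 * B * C * c"
      by (simp add: algebra_simps)
  qed
  with BC show ?thesis
    unfolding tame_def by (intro exI[of _ "2 * B * C"]) auto
qed

lemma tame_prod_list:
  assumes "\<And>j. j \<in> set js \<Longrightarrow> tame n A (f j)"
    and "\<And>j x S c. j \<in> set js \<Longrightarrow> (x, S, c) \<in> A \<Longrightarrow> has_parity (p j) (f j x)"
  shows "tame n A (\<lambda>x. prod_list (map (\<lambda>j. f j x) js))"
  using assms
proof (induction js)
  case Nil
  then show ?case using tame_const[of 1] by simp
next
  case (Cons j js)
  then show ?case by (simp add: tame_mult[of _ _ "p j"])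
qed

end

text \<open>The only edge of \<open>S\<close> that can be added to \<open>{..<k} - {i}\<close> is \<open>i\<close>.\<close>

lemma coeff_le_wnorm_contract:
  assumes x: "\<And>e. e < Suc k \<Longrightarrow> 0 < x e" and S: "S \<subseteq> {..<k}" and i: "i \<in> S"
  shows "\<bar>ecoeff a {..<k}\<bar> * (\<Prod>e<k. x e) \<le> wnorm (Suc k) x (contract S x a)"
proof -
  define J where "J = {..<k} - {i}"
  have J: "finite J" "insert i J = {..<k}" "i \<notin> J" using S i by (auto simp: J_def)
  have fS: "finite S" using S by (rule finite_subset) simp
  have xi: "0 < x i" using S i by (intro x) auto
  have "ecoeff (contract S x a) J
      = (\<Sum>e\<in>S. if e = i then x i * (shuffle_sign {i} J * ecoeff a {..<k}) else 0)"
    unfolding ecoeff_contract[OF J(1)]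
    by (rule sum.cong) (use S J in \<open>auto simp: J_def insert_absorb\<close>)
  then have "\<bar>ecoeff (contract S x a) J\<bar> = x i * \<bar>ecoeff a {..<k}\<bar>"
    using fS i xi by (simp add: sum.delta abs_mult)
  moreover have "(\<Prod>e<k. x e) = x i * (\<Prod>e\<in>J. x e)"
    using J by (metis prod.insert)
  moreover have "\<bar>ecoeff (contract S x a) J\<bar> * (\<Prod>e\<in>J. x e) \<le> wnorm (Suc k) x (contract S x a)"
    by (rule coeff_le_wnorm) (auto simp: J_def x)
  ultimately show ?thesis by (simp add: mult_ac)
qed


section \<open>The Laplacian and its projection\<close>

lemma scalar_prod_self_eq_0:
  fixes v :: "'a::linordered_idom Matrix.vec"
  assumes "v \<bullet> v = 0"
  shows "v = 0\<^sub>v (dim_vec v)"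
proof -
  have "(\<Sum>i\<in>{0..<dim_vec v}. vec_index v i * vec_index v i) = 0"
    using assms by (simp add: scalar_prod_def)
  then have "\<forall>i\<in>{0..<dim_vec v}. vec_index v i * vec_index v i = 0"
    by (subst (asm) sum_nonneg_eq_0_iff) auto
  then show ?thesis by (intro eq_vecI) auto
qed

text \<open>Pairing the hypothesis with \<open>v\<close> gives
  \<open>(N v) \<bullet> (N v) = 0\<close>. The ordered domain is kept general because both integral
  and real matrices occur.\<close>

lemma gram_kernel:
  fixes N :: "'a::linordered_idom mat"
  assumes N: "N \<in> carrier_mat n h" and v: "v \<in> carrier_vec h"
    and "(transpose_mat N * N) *\<^sub>v v = 0\<^sub>v h"
  shows "N *\<^sub>v v = 0\<^sub>v n"
proof -
  have "transpose_mat N *\<^sub>v (N *\<^sub>v v) = 0\<^sub>v h"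
    using assms by (subst assoc_mult_mat_vec[symmetric, of _ h n]) auto
  moreover have "(N *\<^sub>v v) \<bullet> (N *\<^sub>v v) = v \<bullet> (transpose_mat N *\<^sub>v (N *\<^sub>v v))"
    using transpose_vec_mult_scalar[of N n h v "N *\<^sub>v v"] N v
      comm_scalar_prod[of v h "transpose_mat N *\<^sub>v (N *\<^sub>v v)"] by simp
  ultimately have "(N *\<^sub>v v) \<bullet> (N *\<^sub>v v) = 0" using v by simp
  then show ?thesis using scalar_prod_self_eq_0[of "N *\<^sub>v v"] N by simp
qed

text \<open>Injectivity passes from the integers to the reals through the Gram determinant, which is
  the same integer over both: a real kernel vector makes it vanish, and then there is a nonzero
  integral kernel vector.\<close>

lemma real_kernel_trivial:
  fixes H :: "int mat"
  assumes H: "H \<in> carrier_mat n h"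
    and inj: "\<And>a. a \<in> carrier_vec h \<Longrightarrow> H *\<^sub>v a = 0\<^sub>v n \<Longrightarrow> a = 0\<^sub>v h"
    and v: "v \<in> carrier_vec h" "map_mat real_of_int H *\<^sub>v v = 0\<^sub>v n"
  shows "v = 0\<^sub>v h"
proof (rule ccontr)
  assume nz: "v \<noteq> 0\<^sub>v h"
  let ?R = "map_mat real_of_int H"
  have R: "?R \<in> carrier_mat n h" using H by simp
  have "(transpose_mat ?R * ?R) *\<^sub>v v = transpose_mat ?R *\<^sub>v (?R *\<^sub>v v)"
    by (rule assoc_mult_mat_vec[of _ h n]) (use R v in auto)
  also have "\<dots> = 0\<^sub>v h" unfolding v(2) using R by (intro eq_vecI) auto
  finally have "det (transpose_mat ?R * ?R) = 0"
    using v(1) nz R by (subst det_0_iff_vec_prod_zero_field[of _ h]) auto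
  moreover have "transpose_mat ?R * ?R = map_mat of_int (transpose_mat H * H)"
  proof -
    have "transpose_mat ?R = map_mat of_int (transpose_mat H)" by (rule eq_matI) auto
    then show ?thesis using H by (simp add: of_int_hom.mat_hom_mult[of _ h n _ h])
  qed
  ultimately have "det (transpose_mat H * H) = 0"
    by simp
  then obtain w where w: "w \<in> carrier_vec h" "w \<noteq> 0\<^sub>v h" "(transpose_mat H * H) *\<^sub>v w = 0\<^sub>v h"
    using H by (subst (asm) det_0_iff_vec_prod_zero[of _ h]) auto
  with gram_kernel[OF H w(1,3)] inj show False by blast
qed

section \<open>The Laplacian as a Gram matrix and the associated projection\<close>

definition weighted :: "int mat \<Rightarrow> (nat \<Rightarrow> real) \<Rightarrow> real mat" where
  "weighted H x = mat (dim_row H) (dim_col H) (\<lambda>(e, i). sqrt (x e) * real_of_int (H $$ (e, i)))"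

definition inv_laplacian :: "int mat \<Rightarrow> (nat \<Rightarrow> real) \<Rightarrow> real mat" where
  "inv_laplacian H x = the (mat_inverse (laplacian H x))"

text \<open>With \<open>N = D^(1/2) H\<close> this is the formula \<open>N (N^T N)^(-1) N^T\<close>
  for the orthogonal projection onto the columns of \<open>N\<close>.\<close>

definition edge_proj :: "int mat \<Rightarrow> (nat \<Rightarrow> real) \<Rightarrow> real mat" where
  "edge_proj H x = weighted H x * inv_laplacian H x * transpose_mat (weighted H x)"

lemma laplacian_carrier:
  "H \<in> carrier_mat n h \<Longrightarrow> laplacian H x \<in> carrier_mat h h"
  by (auto simp: laplacian_def mat_diag_def)

lemma laplacian_entry:
  assumes H: "H \<in> carrier_mat n h" and ij: "i < h" "j < h"
  shows "laplacian H x $$ (i, j) = (\<Sum>e<n. x e * (of_int (H $$ (e, i)) * of_int (H $$ (e, j))))"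
proof -
  let ?R = "map_mat real_of_int H"
  have c: "transpose_mat ?R \<in> carrier_mat h n" "?R \<in> carrier_mat n h"
      "transpose_mat ?R * mat_diag n x \<in> carrier_mat h n"
    using H by (auto simp: mat_diag_def)
  have "laplacian H x = transpose_mat ?R * mat_diag n x * ?R"
    using H by (simp add: laplacian_def)
  then have "laplacian H x $$ (i, j) = (\<Sum>e<n. (transpose_mat ?R * mat_diag n x) $$ (i, e) * ?R $$ (e, j))"
    using mult_mat_entry[OF c(3,2) ij] by simp
  also have "\<dots> = (\<Sum>e<n. x e * (of_int (H $$ (e, i)) * of_int (H $$ (e, j))))"
    unfolding mat_diag_mult_right[OF c(1)] using H ij by (intro sum.cong) auto
  finally show ?thesis .
qed

context
  fixes H :: "int mat" and n h :: nat
  assumes H: "H \<in> carrier_mat n h"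
    and inj: "\<And>a. a \<in> carrier_vec h \<Longrightarrow> H *\<^sub>v a = 0\<^sub>v n \<Longrightarrow> a = 0\<^sub>v h"
begin

lemma weighted_carrier [simp]: "weighted H x \<in> carrier_mat n h"
  using H by (simp add: weighted_def)

text \<open>The entries are linear in the coordinates, so their partial derivatives are
  constants.\<close>

lemma deriv_laplacian:
  assumes ij: "i < h" "j < h" and e: "e < n"
  shows "deriv (\<lambda>t. laplacian H (x(e := t)) $$ (i, j)) (x e) = of_int (H $$ (e, i)) * of_int (H $$ (e, j))"
proof -
  let ?g = "\<lambda>e. real_of_int (H $$ (e, i)) * of_int (H $$ (e, j))"
  have "laplacian H (x(e := t)) $$ (i, j) = t * ?g e + (\<Sum>f\<in>{..<n} - {e}. x f * ?g f)" for t
    unfolding laplacian_entry[OF H ij] using e by (subst sum.remove[of _ e]) auto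
  moreover have "((\<lambda>t. t * ?g e + (\<Sum>f\<in>{..<n} - {e}. x f * ?g f)) has_field_derivative ?g e) (at (x e))"
    by (auto intro!: derivative_eq_intros)
  ultimately show ?thesis by (simp add: DERIV_imp_deriv)
qed

context
  fixes x :: "nat \<Rightarrow> real"
  assumes x: "\<And>e. e < n \<Longrightarrow> 0 < x e"
begin

lemma laplacian_weighted: "laplacian H x = transpose_mat (weighted H x) * weighted H x"
proof (rule eq_matI)
  fix i j assume "i < dim_row (transpose_mat (weighted H x) * weighted H x)"
    "j < dim_col (transpose_mat (weighted H x) * weighted H x)"
  then have ij: "i < h" "j < h" using H by (auto simp: weighted_def)
  have ct: "transpose_mat (weighted H x) \<in> carrier_mat h n" by simp
  show "laplacian H x $$ (i, j) = (transpose_mat (weighted H x) * weighted H x) $$ (i, j)"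
    unfolding laplacian_entry[OF H ij] mult_mat_entry[OF ct weighted_carrier ij]
  proof (rule sum.cong[OF refl])
    fix e assume "e \<in> {..<n}"
    then have e: "e < n" by simp
    show "x e * (of_int (H $$ (e, i)) * of_int (H $$ (e, j))) =
        transpose_mat (weighted H x) $$ (i, e) * weighted H x $$ (e, j)"
      using H ij e x[OF e] by (simp add: weighted_def mult_ac)
  qed
qed (use H in \<open>auto simp: laplacian_def weighted_def\<close>)

text \<open>A kernel vector of the Gram matrix is killed by \<open>D^(1/2) H\<close>, hence by
  \<open>H\<close> since the weights are positive. This contradicts injectivity over the
  reals.\<close>

lemma det_laplacian: "det (laplacian H x) \<noteq> 0"
proof
  assume "det (laplacian H x) = 0"
  then obtain v where v: "v \<in> carrier_vec h" "v \<noteq> 0\<^sub>v h" "laplacian H x *\<^sub>v v = 0\<^sub>v h"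
    using det_0_iff_vec_prod_zero_field[OF laplacian_carrier[OF H]] by blast
  have Nv: "weighted H x *\<^sub>v v = 0\<^sub>v n"
    using gram_kernel[OF weighted_carrier v(1)] v(3) by (simp add: laplacian_weighted)
  have "map_mat real_of_int H *\<^sub>v v = 0\<^sub>v n"
  proof (rule eq_vecI)
    fix e assume "e < dim_vec (0\<^sub>v n :: real Matrix.vec)"
    then have e: "e < n" by simp
    have "sqrt (x e) * (vec_index (map_mat real_of_int H *\<^sub>v v) e) = vec_index (weighted H x *\<^sub>v v) e"
      using H e v(1) by (auto simp: weighted_def scalar_prod_def sum_distrib_left mult.assoc intro!: sum.cong)
    then show "vec_index (map_mat real_of_int H *\<^sub>v v) e = vec_index (0\<^sub>v n) e"
      using Nv e x[OF e] by simp
  qed (use H in auto)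
  then show False using real_kernel_trivial[OF H inj v(1)] v(2) by blast
qed

text \<open>The nonzero determinant excludes the result \<open>None\<close>, so \<open>the\<close>
  selects a genuine inverse.\<close>

lemma inv_laplacian:
  "inv_laplacian H x \<in> carrier_mat h h"
  "laplacian H x * inv_laplacian H x = 1\<^sub>m h"
  "inv_laplacian H x * laplacian H x = 1\<^sub>m h"
proof -
  have "laplacian H x \<in> Units (ring_mat TYPE(real) h ())"
    by (rule det_non_zero_imp_unit[OF laplacian_carrier[OF H] det_laplacian])
  then have "mat_inverse (laplacian H x) \<noteq> None"
    using mat_inverse(1)[OF laplacian_carrier[OF H], where b = "()"] by auto
  then have "mat_inverse (laplacian H x) = Some (inv_laplacian H x)"
    by (simp add: inv_laplacian_def)
  from mat_inverse(2)[OF laplacian_carrier[OF H] this]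
  show "inv_laplacian H x \<in> carrier_mat h h"
    "laplacian H x * inv_laplacian H x = 1\<^sub>m h"
    "inv_laplacian H x * laplacian H x = 1\<^sub>m h" by auto
qed

lemma transpose_laplacian: "transpose_mat (laplacian H x) = laplacian H x"
  unfolding laplacian_weighted by (subst transpose_mult[of _ h n _ h]) auto

lemma transpose_inv_laplacian: "transpose_mat (inv_laplacian H x) = inv_laplacian H x"
proof -
  note L = laplacian_carrier[OF H, of x] and W = inv_laplacian
  have "transpose_mat (inv_laplacian H x) = transpose_mat (inv_laplacian H x) * (laplacian H x * inv_laplacian H x)"
    using W by simp
  also have "\<dots> = transpose_mat (laplacian H x * inv_laplacian H x) * inv_laplacian H x"
    using W L by (subst transpose_mult[of _ h h _ h])
      (auto simp: transpose_laplacian assoc_mult_mat[of _ h h _ h _ h])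
  also have "\<dots> = inv_laplacian H x" using W by simp
  finally show ?thesis .
qed

lemma edge_proj_carrier: "edge_proj H x \<in> carrier_mat n n"
  using inv_laplacian(1) by (simp add: edge_proj_def mult_carrier_mat[of _ n h])

lemma edge_proj_idem: "edge_proj H x * edge_proj H x = edge_proj H x"
proof -
  let ?N = "weighted H x" and ?W = "inv_laplacian H x"
  note W = inv_laplacian
  have "?N * ?W * transpose_mat ?N * (?N * ?W * transpose_mat ?N)
      = ?N * ?W * (transpose_mat ?N * ?N) * (?W * transpose_mat ?N)"
    using W(1)
    by (simp add: assoc_mult_mat[of _ n h _ n _ n] assoc_mult_mat[of _ n h _ h _ n]
        assoc_mult_mat[of _ h n _ h _ n] assoc_mult_mat[of _ h h _ h _ n] assoc_mult_mat[of _ h h _ n _ n]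
        mult_carrier_mat[of _ n h] mult_carrier_mat[of _ h n] mult_carrier_mat[of _ h h])
  also have "\<dots> = ?N * (?W * laplacian H x) * (?W * transpose_mat ?N)"
    unfolding laplacian_weighted[symmetric] using W(1) laplacian_carrier[OF H, of x]
    by (simp add: assoc_mult_mat[of _ n h _ h _ h])
  also have "\<dots> = ?N * ?W * transpose_mat ?N"
    unfolding W(3) using W(1) by (simp add: assoc_mult_mat[of _ n h _ h _ n] right_mult_one_mat[of _ n])
  finally show ?thesis by (simp add: edge_proj_def)
qed

lemma edge_proj_entry:
  assumes "e < n" "f < n"
  shows "edge_proj H x $$ (e, f) = sqrt (x e) * sqrt (x f) *
    (\<Sum>i<h. of_int (H $$ (e, i)) * (\<Sum>j<h. inv_laplacian H x $$ (i, j) * of_int (H $$ (f, j))))"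
proof -
  let ?N = "weighted H x" and ?W = "inv_laplacian H x"
  have ct: "transpose_mat ?N \<in> carrier_mat h n" by simp
  have cWN: "?W * transpose_mat ?N \<in> carrier_mat h n" using inv_laplacian(1) by simp
  have "edge_proj H x = ?N * (?W * transpose_mat ?N)"
    unfolding edge_proj_def using inv_laplacian(1) by (intro assoc_mult_mat[of _ n h _ h _ n]) auto
  then have "edge_proj H x $$ (e, f) = (\<Sum>i<h. ?N $$ (e, i) * (\<Sum>j<h. ?W $$ (i, j) * transpose_mat ?N $$ (j, f)))"
    using mult_mat_entry[OF weighted_carrier cWN assms] mult_mat_entry[OF inv_laplacian(1) ct _ assms(2)]
    by simp
  also have "\<dots> = sqrt (x e) * sqrt (x f) *
    (\<Sum>i<h. of_int (H $$ (e, i)) * (\<Sum>j<h. ?W $$ (i, j) * of_int (H $$ (f, j))))"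
    unfolding sum_distrib_left by (intro sum.cong refl) (use assms H in \<open>simp add: weighted_def mult_ac\<close>)
  finally show ?thesis .
qed

lemma edge_proj_sym:
  assumes "e < n" "f < n"
  shows "edge_proj H x $$ (e, f) = edge_proj H x $$ (f, e)"
proof -
  have "transpose_mat (edge_proj H x) = edge_proj H x"
    unfolding edge_proj_def using inv_laplacian(1)
    by (simp add: transpose_mult[of _ n h _ n] transpose_mult[of _ n h _ h] transpose_mult[of _ h h _ n] transpose_inv_laplacian
        mult_carrier_mat[of _ n h] assoc_mult_mat[of _ n h _ h _ n])
  then show ?thesis using edge_proj_carrier assms by (metis carrier_matD index_transpose_mat(1))
qed

text \<open>Each \<open>dx\<^sub>e\<close> is written as
  \<open>sqrt (x e) * (dx\<^sub>e / x\<^sub>e) * sqrt (x e)\<close>, and the two square roots go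
  into the two copies of \<open>weighted H x\<close>.\<close>

lemma diff_laplacian:
  "diff_mat n (laplacian H) x =
    map_mat ext_const (transpose_mat (weighted H x)) * dlog n x * map_mat ext_const (weighted H x)"
  (is "_ = ?A * _ * ?B")
proof (rule eq_matI)
  fix i j assume "i < dim_row (?A * dlog n x * ?B)" "j < dim_col (?A * dlog n x * ?B)"
  then have ij: "i < h" "j < h" using H by (auto simp: weighted_def)
  have A: "?A \<in> carrier_mat h n" and B: "?B \<in> carrier_mat n h" by auto
  have const_mult: "ext_const p * (ext_const r * g) * ext_const s = ext_const (s * p * r) * g"
    for p r s :: real and g :: "(nat, real) exterior"
    by (subst ext_const_commute) (simp only: mult.assoc ext_const.hom_mult)
  have AD: "?A * dlog n x \<in> carrier_mat h n" by (rule mult_carrier_mat[OF A dlog_carrier])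
  have "(?A * dlog n x * ?B) $$ (i, j) = (\<Sum>e<n. (?A * dlog n x) $$ (i, e) * ?B $$ (e, j))"
    by (rule mult_mat_entry[OF AD B ij])
  also have "\<dots> = (\<Sum>e<n. ext_const (sqrt (x e) * of_int (H $$ (e, i))) *
      (ext_const (1 / x e) * ext_gen e) * ext_const (sqrt (x e) * of_int (H $$ (e, j))))"
    unfolding dlog_def mat_diag_mult_right[OF A] using H ij by (intro sum.cong) (auto simp: weighted_def)
  also have "\<dots> = (\<Sum>e<n. ext_const (of_int (H $$ (e, i)) * of_int (H $$ (e, j))) * ext_gen e)"
  proof (rule sum.cong[OF refl])
    fix e assume "e \<in> {..<n}"
    then have "0 < x e" by (simp add: x)
    then have *: "sqrt (x e) * b * (sqrt (x e) * a) * (1 / x e) = a * b" for a b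
      by (simp add: field_simps)
    show "ext_const (sqrt (x e) * of_int (H $$ (e, i))) * (ext_const (1 / x e) * ext_gen e) *
        ext_const (sqrt (x e) * of_int (H $$ (e, j)))
      = (ext_const (of_int (H $$ (e, i)) * of_int (H $$ (e, j))) * ext_gen e :: (nat, real) exterior)"
      unfolding const_mult * ..
  qed
  also have "\<dots> = diff_mat n (laplacian H) x $$ (i, j)"
    using ij laplacian_carrier[OF H, of x]
    by (auto simp: diff_mat_def diff_def deriv_laplacian intro!: sum.cong)
  finally show "diff_mat n (laplacian H) x $$ (i, j) = (?A * dlog n x * ?B) $$ (i, j)" ..
qed (use H in \<open>auto simp: diff_mat_def laplacian_def weighted_def\<close>)

text \<open>The matrix in the definition of \<open>omega\<close> factors as \<open>A * B\<close>
  with \<open>B * A = T\<close>, so its powers are \<open>A * T ^\<^sub>m m * B\<close>. Moving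
  \<open>A\<close> to the end of the trace produces no sign, because the entries of \<open>A\<close>
  have degree 0.\<close>

lemma omega_eq: "omega H j x = mat_trace (dlog_proj n x (edge_proj H x) ^\<^sub>m (4 * j + 1))"
proof -
  let ?c = "map_mat ext_const :: real mat \<Rightarrow> (nat, real) exterior mat"
  let ?N = "weighted H x" and ?W = "inv_laplacian H x" and ?Q = "edge_proj H x"
  define A where "A = ?c ?W * ?c (transpose_mat ?N)"
  define B where "B = dlog n x * ?c ?N"
  define T where "T = dlog_proj n x ?Q"
  note D = dlog_carrier[of n x]
  have cW: "?c ?W \<in> carrier_mat h h" and cN: "?c ?N \<in> carrier_mat n h"
    and cNT: "?c (transpose_mat ?N) \<in> carrier_mat h n"
    using inv_laplacian(1) by auto
  have cA: "A \<in> carrier_mat h n" unfolding A_def by (rule mult_carrier_mat[OF cW cNT])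
  have cB: "B \<in> carrier_mat n h" unfolding B_def by (rule mult_carrier_mat[OF D cN])
  have "?c ?Q = ?c ?N * ?c ?W * ?c (transpose_mat ?N)"
    unfolding edge_proj_def using inv_laplacian(1)
    by (simp add: ext_const.mat_hom_mult[of _ n h _ n] ext_const.mat_hom_mult[of _ n h _ h]
        mult_carrier_mat[of _ n h])
  also have "\<dots> = ?c ?N * A"
    unfolding A_def by (rule assoc_mult_mat[OF cN cW cNT])
  finally have T: "B * A = T"
    unfolding T_def dlog_proj_def B_def by (simp add: assoc_mult_mat[OF D cN cA])
  have cT: "T \<in> carrier_mat n n" using T cA cB by (metis mult_carrier_mat)
  have "?c ?W * diff_mat n (laplacian H) x = A * B"
    unfolding diff_laplacian A_def B_def
    using assoc_mult_mat[OF cNT D cN] assoc_mult_mat[OF cW cNT mult_carrier_mat[OF D cN]] by simp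
  then have "omega H j x = mat_trace ((A * B) ^\<^sub>m Suc (4 * j))"
    using H by (simp add: omega_def inv_laplacian_def del: pow_mat.simps)
  also have "(A * B) ^\<^sub>m Suc m = A * (T ^\<^sub>m m * B)" for m
  proof (induction m)
    case 0
    then show ?case using cA cB cT by simp
  next
    case (Suc m)
    have "(A * B) ^\<^sub>m Suc (Suc m) = A * (T ^\<^sub>m m * B) * (A * B)"
      using Suc by simp
    also have "\<dots> = A * (T ^\<^sub>m m * (B * A) * B)"
      using cA cB cT mult_carrier_mat[OF pow_carrier_mat[OF cT, of m] cB] mult_carrier_mat[OF cA cB]
      by (simp add: assoc_mult_mat[of _ h n _ h _ h] assoc_mult_mat[of _ n n _ h _ h]
          assoc_mult_mat[of _ n n _ n _ h] assoc_mult_mat[of _ n h _ n _ h])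
    finally show ?case unfolding T by simp
  qed
  also have "mat_trace (A * (T ^\<^sub>m (4 * j) * B)) = mat_trace (T ^\<^sub>m (4 * j) * B * A)"
  proof -
    have pT: "mat_parity (Suc 0) T"
      unfolding T_def by (rule mat_parity_dlog_proj[OF edge_proj_carrier])
    have pB: "mat_parity (Suc 0 + 0) B"
      unfolding B_def
      by (rule mat_parity_mult[OF D cN mat_parity_dlog mat_parity_const])
    have pA: "mat_parity (0 + 0) A"
      unfolding A_def by (rule mat_parity_mult[OF cW cNT mat_parity_const mat_parity_const])
    note cTB = mult_carrier_mat[OF pow_carrier_mat[OF cT, of "4 * j"] cB]
    show ?thesis
      using mat_trace_graded_cyclic[OF cA cTB pA
          mat_parity_mult[OF pow_carrier_mat[OF cT] cB mat_parity_pow[OF cT pT] pB]] by simp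
  qed
  also have "T ^\<^sub>m (4 * j) * B * A = T ^\<^sub>m (4 * j + 1)"
    using cA cB cT T by (simp add: assoc_mult_mat[of _ n n _ h _ n])
  finally show ?thesis by (simp add: T_def)
qed

end

end


section \<open>Weighted least squares, uniformly in the weights\<close>

text \<open>Bolzano-Weierstrass one coordinate at a time: every induction step passes to a further
  subsequence, along which the earlier limits persist.\<close>

lemma coordinatewise_convergent_subseq:
  fixes z :: "nat \<Rightarrow> nat \<Rightarrow> real"
  assumes "\<And>m j. j < h \<Longrightarrow> \<bar>z m j\<bar> \<le> 1"
  shows "\<exists>r Z. strict_mono r \<and> (\<forall>j<h. (\<lambda>m. z (r m) j) \<longlonglongrightarrow> Z j)"
  using assms
proof (induction h)
  case 0
  show ?case by (rule exI[of _ id]) (simp add: strict_mono_def)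
next
  case (Suc h)
  then obtain r Z where r: "strict_mono r" and Z: "\<And>j. j < h \<Longrightarrow> (\<lambda>m. z (r m) j) \<longlonglongrightarrow> Z j"
    by (meson less_SucI)
  have "bounded (range (\<lambda>m. z (r m) h))"
    using Suc.prems[of h] by (auto simp: bounded_iff intro!: exI[of _ 1])
  then obtain l s where s: "strict_mono s" and l: "((\<lambda>m. z (r m) h) \<circ> s) \<longlonglongrightarrow> l"
    using bounded_imp_convergent_subsequence by blast
  have "(\<lambda>m. z ((r \<circ> s) m) j) \<longlonglongrightarrow> (if j = h then l else Z j)" if "j < Suc h" for j
  proof (cases "j = h")
    case False
    then have "j < h" using that by simp
    from LIMSEQ_subseq_LIMSEQ[OF Z[OF this] s] False show ?thesis by (simp add: o_def)
  qed (use l in \<open>simp add: o_def\<close>)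
  then show ?case
    using strict_mono_o[OF r s] by (intro exI[of _ "r \<circ> s"] exI[of _ "\<lambda>j. if j = h then l else Z j"]) blast
qed

text \<open>If the solutions were unbounded, the normalised fits and residuals would have a common nonzero limit
  in the column space; eventually the residual has the sign of this limit wherever the limit is
  nonzero, so the two cannot be orthogonal for any positive weights.\<close>

lemma weighted_least_squares_bounded:
  fixes B :: "nat \<Rightarrow> nat \<Rightarrow> real"
  assumes inj: "\<And>y. (\<And>e. e < n \<Longrightarrow> (\<Sum>j<h. B e j * y j) = 0) \<Longrightarrow> (\<And>j. j < h \<Longrightarrow> y j = 0)"
  shows "\<exists>C\<ge>0. \<forall>x y f. (\<forall>e<n. 0 < x e) \<and>
    (\<forall>i<h. (\<Sum>e<n. x e * B e i * ((\<Sum>j<h. B e j * y j) - (if e = f then 1 else 0))) = 0)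
    \<longrightarrow> (\<forall>j<h. \<bar>y j\<bar> \<le> C)"
proof -
  \<comment> \<open>These are the normal equations: for \<open>f < n\<close>, \<open>y\<close> gives
    the least squares fit, with weights \<open>x\<close>, of the unit vector \<open>f\<close> by the
    columns of \<open>B\<close>.\<close>
  define sol where "sol x y f \<longleftrightarrow> (\<forall>e<n. 0 < x e) \<and>
    (\<forall>i<h. (\<Sum>e<n. x e * B e i * ((\<Sum>j<h. B e j * y j) - (if e = f then 1 else 0))) = 0)"
    for x y :: "nat \<Rightarrow> real" and f
  have "\<exists>C\<ge>0. \<forall>x y f. sol x y f \<longrightarrow> (\<forall>j<h. \<bar>y j\<bar> \<le> C)"
  proof (rule ccontr)
    assume "\<not> ?thesis"
    then have "\<forall>m. \<exists>x y f. sol x y f \<and> (\<exists>j<h. real m < \<bar>y j\<bar>)"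
      by (metis not_le of_nat_0_le_iff)
    then obtain X Y F where sol: "\<And>m. sol (X m) (Y m) (F m)" and big: "\<And>m. \<exists>j<h. real m < \<bar>Y m j\<bar>"
      by metis
    \<comment> \<open>Dividing by the sum of absolute values keeps all coordinates in
      \<open>[-1, 1]\<close> and prevents the limit from being zero.\<close>
    define M where "M m = (\<Sum>j<h. \<bar>Y m j\<bar>)" for m
    have YM: "\<bar>Y m j\<bar> \<le> M m" if "j < h" for m j
      unfolding M_def using that by (intro member_le_sum) auto
    have M: "real m < M m" for m using big[of m] YM[of _ m] by force
    have Mpos: "0 < M m" for m using M[of m] by linarith
    define z where "z m j = Y m j / M m" for m j
    have "\<bar>z m j\<bar> \<le> 1" if "j < h" for m j
      using YM[OF that, of m] Mpos[of m] by (simp add: z_def)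
    then obtain r Z where r: "strict_mono r" and Z: "\<And>j. j < h \<Longrightarrow> (\<lambda>m. z (r m) j) \<longlonglongrightarrow> Z j"
      using coordinatewise_convergent_subseq[of h z] by metis
    have "(\<Sum>j<h. \<bar>z m j\<bar>) = 1" for m
      using Mpos[of m] by (simp add: z_def M_def[symmetric] sum_divide_distrib[symmetric])
    moreover have "(\<lambda>m. \<Sum>j<h. \<bar>z (r m) j\<bar>) \<longlonglongrightarrow> (\<Sum>j<h. \<bar>Z j\<bar>)"
      by (intro tendsto_sum tendsto_rabs Z) auto
    ultimately have sum1: "(\<Sum>j<h. \<bar>Z j\<bar>) = 1" by (simp add: LIMSEQ_const_iff)
    have "\<not> (\<forall>j<h. Z j = 0)"
    proof
      assume "\<forall>j<h. Z j = 0"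
      then have "(\<Sum>j<h. \<bar>Z j\<bar>) = 0" by simp
      then show False using sum1 by simp
    qed
    define v where "v e = (\<Sum>j<h. B e j * Z j)" for e
    obtain e0 where e0: "e0 < n" "v e0 \<noteq> 0"
      using inj[of Z] \<open>\<not> (\<forall>j<h. Z j = 0)\<close> unfolding v_def by blast
    \<comment> \<open>The residual after normalisation. The unit vector has been divided by
      \<open>M m\<close> and disappears in the limit, so that \<open>u\<close> tends to the same
      \<open>v\<close> as the fit.\<close>
    define u where "u m e = (\<Sum>j<h. B e j * z m j) - (if e = F m then 1 else 0) / M m" for m e
    have inv0: "(\<lambda>m. 1 / M (r m)) \<longlonglongrightarrow> 0"
    proof (rule Lim_null_comparison)
      show "\<forall>\<^sub>F m in sequentially. norm (1 / M (r m)) \<le> 1 / real m"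
      proof (rule eventually_sequentiallyI[of 1])
        fix m :: nat assume "1 \<le> m"
        moreover have "real m \<le> M (r m)"
          using M[of "r m"] seq_suble[OF r, of m] by linarith
        ultimately show "norm (1 / M (r m)) \<le> 1 / real m"
          using Mpos[of "r m"] by (simp add: frac_le)
      qed
      show "(\<lambda>m. 1 / real m) \<longlonglongrightarrow> 0" by (rule lim_1_over_n)
    qed
    have u: "(\<lambda>m. u (r m) e) \<longlonglongrightarrow> v e" for e
    proof -
      have "(\<lambda>m. (if e = F (r m) then 1 else 0) / M (r m)) \<longlonglongrightarrow> 0"
        by (rule Lim_null_comparison[OF _ inv0]) (use Mpos in \<open>auto simp: less_imp_le\<close>)
      then have "(\<lambda>m. u (r m) e) \<longlonglongrightarrow> (\<Sum>j<h. B e j * Z j) - 0"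
        unfolding u_def by (intro tendsto_diff tendsto_sum tendsto_mult tendsto_const Z) auto
      then show ?thesis by (simp add: v_def)
    qed
    have "\<forall>\<^sub>F m in sequentially. v e \<noteq> 0 \<longrightarrow> 0 < v e * u (r m) e" for e
    proof (cases "v e = 0")
      case False
      have "(\<lambda>m. v e * u (r m) e) \<longlonglongrightarrow> v e * v e" by (intro tendsto_mult tendsto_const u)
      moreover have "0 < v e * v e" using False by (auto simp: zero_less_mult_iff)
      ultimately show ?thesis by (auto dest: order_tendstoD(1) elim: eventually_mono)
    qed simp
    then have "\<forall>\<^sub>F m in sequentially. \<forall>e\<in>{..<n}. v e \<noteq> 0 \<longrightarrow> 0 < v e * u (r m) e"
      by (intro eventually_ball_finite) auto
    then obtain m where m: "\<And>e. e < n \<Longrightarrow> v e \<noteq> 0 \<Longrightarrow> 0 < v e * u (r m) e"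
      by (auto simp: eventually_sequentially)
    let ?x = "X (r m)"
    have x: "0 < ?x e" if "e < n" for e using sol[of "r m"] that by (auto simp: sol_def)
    have u_eq: "u (r m) e = ((\<Sum>j<h. B e j * Y (r m) j) - (if e = F (r m) then 1 else 0)) / M (r m)" for e
      by (simp add: u_def z_def diff_divide_distrib sum_divide_distrib)
    have orth: "(\<Sum>e<n. ?x e * B e i * u (r m) e) = 0" if "i < h" for i
      using sol[of "r m"] that unfolding sol_def u_eq times_divide_eq_right sum_divide_distrib[symmetric] by simp
    have "(\<Sum>e<n. ?x e * (v e * u (r m) e)) = (\<Sum>e<n. \<Sum>i<h. Z i * (?x e * B e i * u (r m) e))"
      by (simp add: v_def sum_distrib_left sum_distrib_right mult_ac)
    also have "\<dots> = (\<Sum>i<h. Z i * (\<Sum>e<n. ?x e * B e i * u (r m) e))"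
      by (subst sum.swap) (simp add: sum_distrib_left)
    also have "\<dots> = 0" using orth by simp
    finally have zero: "(\<Sum>e<n. ?x e * (v e * u (r m) e)) = 0" .
    have "0 \<le> ?x e * (v e * u (r m) e)" if "e < n" for e
      using m[OF that] x[OF that] by (cases "v e = 0") (auto intro: less_imp_le)
    then have "?x e0 * (v e0 * u (r m) e0) = 0"
      using zero e0(1) by (subst (asm) sum_nonneg_eq_0_iff) auto
    moreover have "0 < ?x e0 * (v e0 * u (r m) e0)"
      using m[OF e0] x[OF e0(1)] by (rule mult_pos_pos[rotated])
    ultimately show False by (simp only: less_irrefl)
  qed
  then show ?thesis unfolding sol_def .
qed

context
  fixes H :: "int mat" and n h :: nat
  assumes H: "H \<in> carrier_mat n h"
    and inj: "\<And>a. a \<in> carrier_vec h \<Longrightarrow> H *\<^sub>v a = 0\<^sub>v n \<Longrightarrow> a = 0\<^sub>v h"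
begin

text \<open>Column \<open>f\<close> of the projection is \<open>sqrt (x e / x f)\<close> times the
  fit of the unit vector \<open>f\<close>, whose coefficients are bounded uniformly in the weights.
  By symmetry of the projection the smaller of the two coordinates may be put in the numerator,
  which produces the absolute value.\<close>

lemma edge_proj_bound:
  obtains C where "0 \<le> C" and "\<And>x e f. (\<And>e. e < n \<Longrightarrow> 0 < x e) \<Longrightarrow> e < n \<Longrightarrow> f < n \<Longrightarrow>
    \<bar>edge_proj H x $$ (e, f)\<bar> \<le> C * exp (- \<bar>ln (x e) - ln (x f)\<bar> / 2)"
proof -
  let ?B = "\<lambda>e j. real_of_int (H $$ (e, j))"
  have "y j = 0" if y: "\<And>e. e < n \<Longrightarrow> (\<Sum>j<h. ?B e j * y j) = 0" and j: "j < h" for y j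
  proof -
    have "Matrix.vec h y = 0\<^sub>v h"
    proof (rule real_kernel_trivial[OF H inj])
      show "map_mat real_of_int H *\<^sub>v Matrix.vec h y = 0\<^sub>v n"
        using y H by (intro eq_vecI) (auto simp: scalar_prod_def lessThan_atLeast0)
    qed auto
    then show ?thesis using j by (metis index_vec index_zero_vec(1))
  qed
  then obtain C where C: "0 \<le> C"
    and bd: "\<And>x y f. (\<forall>e<n. 0 < x e) \<and>
      (\<forall>i<h. (\<Sum>e<n. x e * ?B e i * ((\<Sum>j<h. ?B e j * y j) - (if e = f then 1 else 0))) = 0)
      \<Longrightarrow> \<forall>j<h. \<bar>y j\<bar> \<le> C"
    using weighted_least_squares_bounded[where n = n and h = h and B = "\<lambda>e j. real_of_int (H $$ (e, j))"] by blast
  define C' where "C' = (\<Sum>e<n. \<Sum>i<h. \<bar>?B e i\<bar>) * C"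
  have C': "0 \<le> C'" unfolding C'_def using C by (intro mult_nonneg_nonneg sum_nonneg) auto
  have half: "\<bar>edge_proj H x $$ (e, f)\<bar> \<le> C' * exp ((ln (x e) - ln (x f)) / 2)"
    if x: "\<And>e. e < n \<Longrightarrow> 0 < x e" and e: "e < n" and f: "f < n" for x e f
  proof -
    let ?W = "inv_laplacian H x"
    note W = inv_laplacian[of H n h x, OF H inj x]
    \<comment> \<open>The solution of the normal equations for the unit vector \<open>f\<close>; the
      factor \<open>x f\<close> is the weight on the right-hand side.\<close>
    define y where "y i = x f * (\<Sum>j<h. ?W $$ (i, j) * ?B f j)" for i
    have LW: "(\<Sum>i<h. laplacian H x $$ (l, i) * ?W $$ (i, j)) = (if l = j then 1 else 0)" if "l < h" "j < h" for l j
      using mult_mat_entry[OF laplacian_carrier[OF H, of x] W(1) that] W(2) that by (simp del: index_mult_mat(1))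
    have normal: "(\<Sum>e<n. x e * ?B e l * ((\<Sum>i<h. ?B e i * y i) - (if e = f then 1 else 0))) = 0"
      if l: "l < h" for l
    proof -
      have "(\<Sum>e<n. x e * ?B e l * (\<Sum>i<h. ?B e i * y i)) = (\<Sum>i<h. (\<Sum>e<n. x e * (?B e l * ?B e i)) * y i)"
        unfolding sum_distrib_left sum_distrib_right by (subst sum.swap) (simp add: mult_ac)
      also have "\<dots> = (\<Sum>i<h. laplacian H x $$ (l, i) * y i)"
        using l by (intro sum.cong refl) (simp add: laplacian_entry[OF H])
      also have "\<dots> = (\<Sum>i<h. \<Sum>j<h. x f * ?B f j * (laplacian H x $$ (l, i) * ?W $$ (i, j)))"
        by (simp add: y_def sum_distrib_left mult_ac)
      also have "\<dots> = (\<Sum>j<h. x f * ?B f j * (\<Sum>i<h. laplacian H x $$ (l, i) * ?W $$ (i, j)))"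
        by (subst sum.swap) (simp add: sum_distrib_left)
      also have "\<dots> = (\<Sum>j<h. if l = j then x f * ?B f j else 0)"
        using l by (intro sum.cong refl) (simp add: LW)
      also have "\<dots> = x f * ?B f l" using l by simp
      also have "\<dots> = (\<Sum>e<n. if e = f then x e * ?B e l else 0)" using f by simp
      also have "\<dots> = (\<Sum>e<n. x e * ?B e l * (if e = f then 1 else 0))"
        by (intro sum.cong) auto
      finally show ?thesis by (simp add: right_diff_distrib sum_subtractf)
    qed
    have yC: "\<bar>y j\<bar> \<le> C" if "j < h" for j using bd[where x = x and y = y and f = f] x normal that by blast
    have "\<bar>\<Sum>i<h. ?B e i * y i\<bar> \<le> (\<Sum>i<h. \<bar>?B e i\<bar> * C)"
      by (rule order_trans[OF sum_abs sum_mono]) (auto simp: abs_mult intro!: mult_left_mono yC)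
    also have "\<dots> = (\<Sum>i<h. \<bar>?B e i\<bar>) * C" by (simp add: sum_distrib_right)
    also have "\<dots> \<le> C'"
      unfolding C'_def using e C
      by (intro mult_right_mono member_le_sum[of e "{..<n}" "\<lambda>e. \<Sum>i<h. \<bar>?B e i\<bar>"]) (auto intro: sum_nonneg)
    finally have le: "\<bar>\<Sum>i<h. ?B e i * y i\<bar> \<le> C'" .
    have sqrt: "sqrt t = exp (ln t / 2)" if "0 < t" for t :: real
      using that by (simp add: ln_sqrt[symmetric])
    have "sqrt (x f) * sqrt (x f) = x f" using x[OF f] by simp
    then have sf: "sqrt (x f) = x f / sqrt (x f)" using x[OF f] by (simp add: field_simps)
    have "edge_proj H x $$ (e, f) = sqrt (x e) * sqrt (x f) *
        (\<Sum>i<h. ?B e i * (\<Sum>j<h. ?W $$ (i, j) * ?B f j))"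
      by (rule edge_proj_entry[OF H inj x e f])
    also have "\<dots> = sqrt (x e) / sqrt (x f) * (\<Sum>i<h. ?B e i * y i)"
      by (subst sf) (simp add: y_def sum_distrib_left mult_ac)
    also have "sqrt (x e) / sqrt (x f) = exp ((ln (x e) - ln (x f)) / 2)"
      using x[OF e] x[OF f] by (simp add: sqrt exp_diff[symmetric] diff_divide_distrib)
    finally show ?thesis
      using le by (simp add: abs_mult mult.commute)
  qed
  have "\<bar>edge_proj H x $$ (e, f)\<bar> \<le> C' * exp (- \<bar>ln (x e) - ln (x f)\<bar> / 2)"
    if x: "\<And>e. e < n \<Longrightarrow> 0 < x e" and "e < n" "f < n" for x e f
  proof (cases "ln (x e) \<le> ln (x f)")
    case True
    then show ?thesis using half[of x e f] that by simp
  next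
    case False
    then show ?thesis
      using half[of x f e] edge_proj_sym[of H n h x, OF H inj x that(2,3)] that by simp
  qed
  with C' that show ?thesis by blast
qed

end


section \<open>Decay of the integrand\<close>

text \<open>Cutting \<open>[0, t]\<close> into \<open>k + 2\<close> half-open intervals, one of them contains none of the \<open>k + 1\<close> points.\<close>

lemma exists_gap:
  fixes g :: "nat \<Rightarrow> real"
  assumes "g k = 0" "e0 < k" "g e0 = t" "0 < t"
  obtains S where "S \<subseteq> {..<k}" "e0 \<in> S"
    "\<And>e f. e \<in> S \<Longrightarrow> f < Suc k \<Longrightarrow> f \<notin> S \<Longrightarrow> t / real (k + 2) \<le> g e - g f"
proof -
  \<comment> \<open>After rescaling, the \<open>k + 2\<close> intervals have unit length and are
    indexed by their floors.\<close>
  define a where "a e = g e * real (k + 2) / t" for e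
  have "card ((\<lambda>e. \<lfloor>a e\<rfloor>) ` {..k}) \<le> k + 1"
    using card_image_le[of "{..k}" "\<lambda>e. \<lfloor>a e\<rfloor>"] by simp
  moreover have "card {0..int k + 1} = k + 2" by simp
  ultimately have "\<not> {0..int k + 1} \<subseteq> (\<lambda>e. \<lfloor>a e\<rfloor>) ` {..k}"
    using card_mono[of "(\<lambda>e. \<lfloor>a e\<rfloor>) ` {..k}" "{0..int k + 1}"] by auto
  then obtain j where "j \<in> {0..int k + 1}" and nj: "j \<notin> (\<lambda>e. \<lfloor>a e\<rfloor>) ` {..k}" by blast
  then have j: "0 \<le> j" "j \<le> int k + 1" by auto
  have j3: "\<lfloor>a e\<rfloor> \<noteq> j" if "e \<le> k" for e using nj that by blast
  \<comment> \<open>The points above the empty interval \<open>[j, j + 1)\<close>. The edge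
    \<open>k\<close> sits at height 0 and stays below it, while \<open>e0\<close> at height
    \<open>k + 2\<close> lies above.\<close>
  define S where "S = {e. e \<le> k \<and> of_int j + 1 \<le> a e}"
  have ak: "a k = 0" using assms by (simp add: a_def)
  have ae: "a e0 = real (k + 2)" using assms by (simp add: a_def)
  have "k \<notin> S" using j(1) by (simp add: S_def ak)
  then have "S \<subseteq> {..<k}" by (auto simp: S_def le_less)
  moreover have "e0 \<in> S"
  proof -
    have "real_of_int j \<le> real_of_int (int k + 1)" using j(2) by (simp only: of_int_le_iff)
    then show ?thesis using assms(2) by (simp add: S_def ae)
  qed
  moreover have "t / real (k + 2) \<le> g e - g f" if e: "e \<in> S" and f: "f < Suc k" "f \<notin> S" for e f
  proof -
    have "a f < of_int j + 1" using f by (auto simp: S_def)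
    then have "\<lfloor>a f\<rfloor> < j + 1" unfolding floor_less_iff by simp
    with j3[of f] f(1) have "\<lfloor>a f\<rfloor> < j" by simp
    then have "a f < of_int j" by (simp add: floor_less_iff)
    moreover have "of_int j + 1 \<le> a e" using e by (simp add: S_def)
    ultimately have "1 \<le> a e - a f" by simp
    also have "a e - a f = (g e - g f) * real (k + 2) / t"
      by (simp add: a_def diff_divide_distrib left_diff_distrib)
    finally have "t \<le> (g e - g f) * real (k + 2)" using assms(4) by (simp add: le_divide_eq)
    then show ?thesis by (simp add: pos_divide_le_eq)
  qed
  ultimately show ?thesis using that by blast
qed

definition separated_cuts :: "nat \<Rightarrow> ((nat \<Rightarrow> real) \<times> nat set \<times> real) set" where
  "separated_cuts k = {(x, S, c). (\<forall>e<Suc k. 0 < x e) \<and> S \<subseteq> {..<k} \<and> 0 \<le> c \<and>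
     (\<forall>e\<in>S. \<forall>f<Suc k. f \<notin> S \<longrightarrow> exp (- \<bar>ln (x e) - ln (x f)\<bar> / 2) \<le> c)}"

context
  fixes H :: "int mat" and k h :: nat
  assumes H: "H \<in> carrier_mat (Suc k) h"
    and inj: "\<And>a. a \<in> carrier_vec h \<Longrightarrow> H *\<^sub>v a = 0\<^sub>v (Suc k) \<Longrightarrow> a = 0\<^sub>v h"
begin

lemma has_parity_omega:
  assumes x: "\<And>e. e < Suc k \<Longrightarrow> 0 < x e"
  shows "has_parity (4 * j + 1) (omega H j x)"
proof -
  have Q: "edge_proj H x \<in> carrier_mat (Suc k) (Suc k)" by (rule edge_proj_carrier[OF H inj x])
  note T = dlog_proj_carrier[OF Q, of x]
  have "has_parity (4 * j + 1) (mat_trace (dlog_proj (Suc k) x (edge_proj H x) ^\<^sub>m (4 * j + 1)))"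
    by (rule mat_parity_trace[OF pow_carrier_mat[OF T] mat_parity_pow[OF T mat_parity_dlog_proj[OF Q]]])
  then show ?thesis by (subst omega_eq[OF H inj x])
qed

text \<open>Entries of the projection are at most \<open>C\<close> everywhere and at most
  \<open>C * c\<close> across the cut. The assumption \<open>1 \<le> j\<close> makes the exponent
  \<open>m\<close> exceed 1, so that an even power of positive exponent remains after
  contraction.\<close>

lemma tame_omega:
  assumes j: "1 \<le> j"
  shows "tame (Suc k) (separated_cuts k) (omega H j)"
proof -
  define n m where "n = Suc k" and "m = 4 * j + 1"
  obtain C where C: "0 \<le> C" and Qb: "\<And>x e f. (\<And>e. e < Suc k \<Longrightarrow> 0 < x e) \<Longrightarrow> e < Suc k \<Longrightarrow> f < Suc k \<Longrightarrow>
    \<bar>edge_proj H x $$ (e, f)\<bar> \<le> C * exp (- \<bar>ln (x e) - ln (x f)\<bar> / 2)"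
    using edge_proj_bound[OF H inj] by blast
  define q where "q = real (n * n) * C"
  define B1 where "B1 = real (n * n) * (real n * q) ^ m"
  define B2 where "B2 = real m * (real (n * n) * (real n * q) ^ (m - 2) * real n * q * (1 + q))"
  have q: "0 \<le> q" and B: "0 \<le> B1" "0 \<le> B2" using C by (auto simp: q_def B1_def B2_def)
  have "wnorm n x (omega H j x) \<le> B1 + B2 \<and> wnorm n x (contract S x (omega H j x)) \<le> (B1 + B2) * c"
    if A: "(x, S, c) \<in> separated_cuts k" for x S c
  proof -
    let ?Q = "edge_proj H x"
    have x: "\<And>e. e < n \<Longrightarrow> 0 < x e" and S: "S \<subseteq> {..<n}" and c: "0 \<le> c"
      and cut: "\<And>e f. e \<in> S \<Longrightarrow> f < n \<Longrightarrow> f \<notin> S \<Longrightarrow> exp (- \<bar>ln (x e) - ln (x f)\<bar> / 2) \<le> c"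
      using A by (auto simp: separated_cuts_def n_def)
    have Q: "?Q \<in> carrier_mat n n" and QQ: "?Q * ?Q = ?Q"
      using edge_proj_carrier[of H "Suc k" h x, OF H inj] edge_proj_idem[of H "Suc k" h x, OF H inj] x
      by (auto simp: n_def)
    have Qe: "\<bar>?Q $$ (e, f)\<bar> \<le> C * exp (- \<bar>ln (x e) - ln (x f)\<bar> / 2)" if "e < n" "f < n" for e f
      using Qb[of x e f] x that by (simp add: n_def)
    have QC: "\<bar>?Q $$ (e, f)\<bar> \<le> C" if "e < n" "f < n" for e f
      using Qe[OF that] mult_left_mono[OF _ C, of "exp (- \<bar>ln (x e) - ln (x f)\<bar> / 2)" 1] by simp
    have Qc: "\<bar>?Q $$ (e, f)\<bar> \<le> C * c" if ef: "e < n" "f < n" and cross: "e \<in> S \<longleftrightarrow> f \<notin> S" for e f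
    proof -
      have "exp (- \<bar>ln (x e) - ln (x f)\<bar> / 2) \<le> c"
        using cut[of e f] cut[of f e] ef cross by (cases "e \<in> S") (auto simp: abs_minus_commute)
      then show ?thesis using Qe[OF ef] C by (meson mult_left_mono order_trans)
    qed
    have om: "omega H j x = mat_trace (dlog_proj n x ?Q ^\<^sub>m m)"
      using omega_eq[of H "Suc k" h x j, OF H inj] x by (simp add: n_def m_def)
    have 1: "wnorm n x (omega H j x) \<le> B1"
      unfolding om B1_def q_def using wnorm_trace_dlog_proj_pow[of n x ?Q C m] x Q QC C by simp
    have "wnorm n x (contract S x (omega H j x))
      \<le> real m * (real (n * n) * (real n * q) ^ (m - 2) * real n * (real (n * n) * (C * c)) * (1 + q))"
      unfolding om q_def
      by (rule wnorm_contract_trace_odd_pow[of n x ?Q C S "C * c" m])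
        (use x Q QC C S QQ Qc c j in \<open>auto simp: m_def\<close>)
    also have "\<dots> = B2 * c" by (simp add: B2_def q_def)
    finally have 2: "wnorm n x (contract S x (omega H j x)) \<le> B2 * c" .
    show ?thesis using 1 2 B mult_nonneg_nonneg[OF B(1) c] by (auto simp: distrib_right)
  qed
  with B show ?thesis unfolding tame_def n_def by (intro exI[of _ "B1 + B2"]) auto
qed

lemma tame_canonical_form:
  assumes K: "\<And>K. ecoeff \<omega> K \<noteq> 0 \<Longrightarrow> K \<subseteq> {1..}"
  shows "tame (Suc k) (separated_cuts k) (canonical_form H \<omega>)"
proof -
  have pos: "0 < x e" if "(x, S, c) \<in> separated_cuts k" "e < Suc k" for x S c e
    using that by (auto simp: separated_cuts_def)
  have c: "0 \<le> c" if "(x, S, c) \<in> separated_cuts k" for x S c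
    using that by (auto simp: separated_cuts_def)
  have "tame (Suc k) (separated_cuts k) (\<lambda>x. \<Sum>K | ecoeff \<omega> K \<noteq> 0. ext_const (of_rat (ecoeff \<omega> K)) *
     prod_list (map (\<lambda>j. omega H j x) (sorted_list_of_set K)))"
  proof (rule tame_sum)
    fix K assume "K \<in> {K. ecoeff \<omega> K \<noteq> 0}"
    then have K1: "K \<subseteq> {1..}" and fin: "finite K" using K ecoeff[of \<omega>] by auto
    have "tame (Suc k) (separated_cuts k) (\<lambda>x. prod_list (map (\<lambda>j. omega H j x) (sorted_list_of_set K)))"
    proof (rule tame_prod_list[where p = "\<lambda>j. 4 * j + 1"])
      fix j assume "j \<in> set (sorted_list_of_set K)"
      then have "1 \<le> j" using K1 fin by auto
      then show "tame (Suc k) (separated_cuts k) (omega H j)" by (rule tame_omega)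
    next
      fix j x S c assume "(x, S, c) \<in> separated_cuts k"
      then show "has_parity (4 * j + 1) (omega H j x)" by (intro has_parity_omega) (rule pos)
    qed (use pos c in auto)
    then show "tame (Suc k) (separated_cuts k) (\<lambda>x. ext_const (of_rat (ecoeff \<omega> K)) *
        prod_list (map (\<lambda>j. omega H j x) (sorted_list_of_set K)))"
      by (intro tame_mult[where p = 0] tame_const) (use pos c in auto)
  qed (use pos c in auto)
  then show ?thesis by (simp add: canonical_form_def[abs_def])
qed

text \<open>For each edge \<open>e0\<close>, a cut at a large gap between \<open>ln (x e0)\<close>
  and \<open>ln (x k) = 0\<close> yields decay in \<open>|ln (x e0)|\<close>. Applied to the edge
  where this is largest, it yields decay in the sum of all \<open>|ln (x e)|\<close>, and the
  exponential of the sum is a product.\<close>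

lemma canonical_form_coeff_bound:
  assumes K: "\<And>K. ecoeff \<omega> K \<noteq> 0 \<Longrightarrow> K \<subseteq> {1..}"
  obtains \<epsilon> C :: real where "0 < \<epsilon>"
    and "\<forall>x. (\<forall>e<k. 0 < x e) \<and> x k = 1 \<longrightarrow>
      \<bar>ecoeff (canonical_form H \<omega> x) {..<k}\<bar> \<le> C * (\<Prod>e<k. exp (- \<epsilon> * \<bar>ln (x e)\<bar>) / x e)"
proof -
  have "tame (Suc k) (separated_cuts k) (canonical_form H \<omega>)"
    by (rule tame_canonical_form) (rule K)
  then obtain C where C: "0 \<le> C" and "\<forall>(x, S, c)\<in>separated_cuts k.
      wnorm (Suc k) x (canonical_form H \<omega> x) \<le> C \<and>
      wnorm (Suc k) x (contract S x (canonical_form H \<omega> x)) \<le> C * c"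
    unfolding tame_def by (elim exE conjE)
  then have bd: "wnorm (Suc k) x (canonical_form H \<omega> x) \<le> C \<and>
      wnorm (Suc k) x (contract S x (canonical_form H \<omega> x)) \<le> C * c"
    if "(x, S, c) \<in> separated_cuts k" for x S c
    using that by fast
  \<comment> \<open>The factor \<open>1 / (k + 2)\<close> is the guaranteed share of the gap and the
    half comes from the exponent in the projection bound. Passing from a maximum to a sum costs the
    \<open>k + 1\<close> in \<open>\<epsilon>\<close>, which is positive even for
    \<open>k = 0\<close>.\<close>
  define \<delta> where "\<delta> = 1 / real (k + 2) / 2"
  define \<epsilon> where "\<epsilon> = \<delta> / real (k + 1)"
  have \<delta>: "0 < \<delta>" and \<epsilon>: "0 < \<epsilon>" by (auto simp: \<delta>_def \<epsilon>_def)
  show ?thesis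
  proof (rule that[OF \<epsilon>], intro allI impI)
    fix x :: "nat \<Rightarrow> real"
    assume "(\<forall>e<k. 0 < x e) \<and> x k = 1"
    then have pos: "0 < x e" if "e < k" for e using that by simp
    have xk: "x k = 1" using \<open>(\<forall>e<k. 0 < x e) \<and> x k = 1\<close> by simp
    \<comment> \<open>The absolute value of the coefficient with respect to the logarithmic
      differentials.\<close>
    define F where "F = \<bar>ecoeff (canonical_form H \<omega> x) {..<k}\<bar> * (\<Prod>e<k. x e)"
    have x: "0 < x e" if "e < Suc k" for e using pos[of e] xk that by (cases "e = k") auto
    have "(x, {}, 0) \<in> separated_cuts k" using x by (simp add: separated_cuts_def)
    from bd[OF this] have FC: "F \<le> C"
      unfolding F_def by (intro order_trans[OF coeff_le_wnorm[of "Suc k" x]]) (use x in auto)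
    have each: "F \<le> C * exp (- \<delta> * \<bar>ln (x e0)\<bar>)" if e0: "e0 < k" for e0
    proof (cases "ln (x e0) = 0")
      case True
      then show ?thesis using FC by simp
    next
      case False
      \<comment> \<open>The sign makes \<open>g e0\<close> positive, so coordinates above and below
        1 are treated alike; \<open>g k = 0\<close> because \<open>x k = 1\<close>.\<close>
      define g where "g e = sgn (ln (x e0)) * ln (x e)" for e
      have g0: "g e0 = \<bar>ln (x e0)\<bar>" by (simp add: g_def abs_sgn mult.commute)
      obtain S where S: "S \<subseteq> {..<k}" "e0 \<in> S"
        "\<And>e f. e \<in> S \<Longrightarrow> f < Suc k \<Longrightarrow> f \<notin> S \<Longrightarrow> \<bar>ln (x e0)\<bar> / real (k + 2) \<le> g e - g f"
        using exists_gap[of g k e0 "\<bar>ln (x e0)\<bar>"] e0 g0 False xk by (auto simp: g_def)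
      have "exp (- \<bar>ln (x e) - ln (x f)\<bar> / 2) \<le> exp (- \<delta> * \<bar>ln (x e0)\<bar>)"
        if "e \<in> S" "f < Suc k" "f \<notin> S" for e f
      proof -
        have "g e - g f = sgn (ln (x e0)) * (ln (x e) - ln (x f))"
          by (simp add: g_def right_diff_distrib)
        also have "\<dots> \<le> \<bar>ln (x e) - ln (x f)\<bar>"
          by (cases "ln (x e0) > 0") (use False in \<open>auto simp: sgn_if\<close>)
        finally have "\<bar>ln (x e0)\<bar> / real (k + 2) \<le> \<bar>ln (x e) - ln (x f)\<bar>"
          using S(3)[OF that] by linarith
        then have "\<bar>ln (x e0)\<bar> / real (k + 2) / 2 \<le> \<bar>ln (x e) - ln (x f)\<bar> / 2"
          by (rule divide_right_mono) simp
        moreover have "\<delta> * \<bar>ln (x e0)\<bar> = \<bar>ln (x e0)\<bar> / real (k + 2) / 2"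
          by (simp only: \<delta>_def times_divide_eq_left mult_1_left)
        ultimately show ?thesis by simp
      qed
      then have "(x, S, exp (- \<delta> * \<bar>ln (x e0)\<bar>)) \<in> separated_cuts k"
        using x S(1) by (auto simp: separated_cuts_def)
      from bd[OF this] have "wnorm (Suc k) x (contract S x (canonical_form H \<omega> x)) \<le> C * exp (- \<delta> * \<bar>ln (x e0)\<bar>)"
        by simp
      moreover have "F \<le> wnorm (Suc k) x (contract S x (canonical_form H \<omega> x))"
        unfolding F_def by (rule coeff_le_wnorm_contract[OF _ S(1,2)]) (rule x)
      ultimately show ?thesis by linarith
    qed
    have "F \<le> C * exp (- \<epsilon> * (\<Sum>e<k. \<bar>ln (x e)\<bar>))"
    proof (cases "k = 0")
      case True
      then show ?thesis using FC by simp
    next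
      case False
      then have ne: "(\<lambda>e. \<bar>ln (x e)\<bar>) ` {..<k} \<noteq> {}" by auto
      then have "Max ((\<lambda>e. \<bar>ln (x e)\<bar>) ` {..<k}) \<in> (\<lambda>e. \<bar>ln (x e)\<bar>) ` {..<k}" by (intro Max_in) auto
      then obtain e0 where e0: "e0 < k" "\<bar>ln (x e0)\<bar> = Max ((\<lambda>e. \<bar>ln (x e)\<bar>) ` {..<k})" by auto
      have "(\<Sum>e<k. \<bar>ln (x e)\<bar>) \<le> (\<Sum>e<k. \<bar>ln (x e0)\<bar>)"
        unfolding e0(2) by (intro sum_mono Max_ge) auto
      also have "\<dots> \<le> real (k + 1) * \<bar>ln (x e0)\<bar>" by (simp add: distrib_right)
      finally have "\<epsilon> * (\<Sum>e<k. \<bar>ln (x e)\<bar>) \<le> \<epsilon> * (real (k + 1) * \<bar>ln (x e0)\<bar>)"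
        using \<epsilon> by (intro mult_left_mono) auto
      also have "\<dots> = \<delta> * \<bar>ln (x e0)\<bar>" by (simp add: \<epsilon>_def)
      finally have "exp (- \<delta> * \<bar>ln (x e0)\<bar>) \<le> exp (- \<epsilon> * (\<Sum>e<k. \<bar>ln (x e)\<bar>))" by simp
      from order_trans[OF each[OF e0(1)] mult_left_mono[OF this C]] show ?thesis .
    qed
    also have "exp (- \<epsilon> * (\<Sum>e<k. \<bar>ln (x e)\<bar>)) = (\<Prod>e<k. exp (- \<epsilon> * \<bar>ln (x e)\<bar>))"
      by (simp add: exp_sum[symmetric] sum_distrib_left sum_negf)
    finally have "F \<le> C * (\<Prod>e<k. exp (- \<epsilon> * \<bar>ln (x e)\<bar>))" .
    moreover have P: "0 < (\<Prod>e<k. x e)" using pos by (intro prod_pos) auto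
    ultimately show "\<bar>ecoeff (canonical_form H \<omega> x) {..<k}\<bar>
        \<le> C * (\<Prod>e<k. exp (- \<epsilon> * \<bar>ln (x e)\<bar>) / x e)"
      unfolding F_def by (simp add: prod_dividef pos_le_divide_eq)
  qed
qed

end


section \<open>Integrability of the one-variable majorant\<close>

lemma integrable_exp_abs_ln:
  fixes \<epsilon> :: real
  assumes "0 < \<epsilon>"
  shows "integrable lborel (\<lambda>y. indicator {0<..} y * (exp (- \<epsilon> * \<bar>ln y\<bar>) / y))"
proof -
  \<comment> \<open>With \<open>u = y^\<epsilon>\<close> the function \<open>g\<close> is the
    density of \<open>du / (1 + u^2)\<close>, and its antiderivative \<open>G\<close> runs from 0 to
    \<open>pi / 2\<close>.\<close>
  define G where "G y = arctan (exp (\<epsilon> * ln y))" for y :: real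
  define g where "g y = \<epsilon> * exp (\<epsilon> * ln y) / (y * (1 + (exp (\<epsilon> * ln y))\<^sup>2))" for y :: real
  have "set_integrable lborel (einterval 0 \<infinity>) g"
  proof (rule interval_integral_FTC_nonneg[where F = G and A = 0 and B = "pi / 2"])
    fix x :: real assume "0 < ereal x"
    then have x: "0 < x" by simp
    have "DERIV (\<lambda>y. exp (\<epsilon> * ln y)) x :> exp (\<epsilon> * ln x) * (\<epsilon> * (1 / x))"
      by (rule DERIV_chain2[OF DERIV_exp DERIV_cmult[OF DERIV_ln_divide[OF x]]])
    from DERIV_chain2[OF DERIV_arctan this] show "DERIV G x :> g x"
      unfolding G_def g_def by (simp add: divide_inverse mult_ac)
    have "x * (1 + (exp (\<epsilon> * ln x))\<^sup>2) \<noteq> 0"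
      using x by (simp add: add_nonneg_eq_0_iff)
    then show "isCont g x"
      unfolding g_def using x by (intro continuous_intros) auto
  next
    show "AE x in lborel. 0 < ereal x \<longrightarrow> ereal x < \<infinity> \<longrightarrow> 0 \<le> g x"
      using assms by (auto simp: g_def)
  next
    have "filterlim (\<lambda>y. \<epsilon> * ln y) at_bot (at_right (0::real))"
      using filterlim_tendsto_pos_mult_at_bot[OF tendsto_const assms ln_at_0] .
    then have "((\<lambda>y. exp (\<epsilon> * ln y)) \<longlongrightarrow> 0) (at_right (0::real))"
      by (rule filterlim_compose[OF exp_at_bot])
    then have "(G \<longlongrightarrow> arctan 0) (at_right 0)"
      unfolding G_def by (intro tendsto_arctan)
    then show "((G \<circ> real_of_ereal) \<longlongrightarrow> 0) (at_right 0)"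
      by (simp add: zero_ereal_def ereal_tendsto_simps)
  next
    have "filterlim (\<lambda>y. \<epsilon> * ln y) at_top (at_top :: real filter)"
      using filterlim_tendsto_pos_mult_at_top[OF tendsto_const assms ln_at_top] .
    then have "filterlim (\<lambda>y. exp (\<epsilon> * ln y)) at_top (at_top :: real filter)"
      by (rule filterlim_compose[OF exp_at_top])
    then have "(G \<longlongrightarrow> pi / 2) at_top"
      unfolding G_def by (rule filterlim_compose[OF tendsto_arctan_at_top])
    then show "((G \<circ> real_of_ereal) \<longlongrightarrow> pi / 2) (at_left \<infinity>)"
      by (simp add: ereal_tendsto_simps)
  qed auto
  moreover have "einterval 0 \<infinity> = {0<..}" by (auto simp: einterval_def zero_ereal_def)
  ultimately have "integrable lborel (\<lambda>y. 2 / \<epsilon> * (indicator {0<..} y *\<^sub>R g y))"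
    unfolding set_integrable_def by (intro integrable_mult_right) simp
  then show ?thesis
  proof (rule Bochner_Integration.integrable_bound)
    show "AE y in lborel. norm (indicator {0<..} y * (exp (- \<epsilon> * \<bar>ln y\<bar>) / y))
        \<le> norm (2 / \<epsilon> * (indicator {0<..} y *\<^sub>R g y))"
    proof (rule AE_I2)
      fix y :: real
      show "norm (indicator {0<..} y * (exp (- \<epsilon> * \<bar>ln y\<bar>) / y))
        \<le> norm (2 / \<epsilon> * (indicator {0<..} y *\<^sub>R g y))"
      proof (cases "0 < y")
        case True
        define u where "u = exp (\<epsilon> * ln y)"
        have u: "0 < u" by (simp add: u_def)
        \<comment> \<open>The left factor is the minimum of \<open>u\<close> and
          \<open>1 / u\<close>, which is at most \<open>2 u / (1 + u^2)\<close>; the sign of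
          \<open>ln y\<close> decides which one it is.\<close>
        have "exp (- \<epsilon> * \<bar>ln y\<bar>) * (1 + u\<^sup>2) \<le> 2 * u"
        proof (cases "0 \<le> ln y")
          case True
          then have eq: "exp (- \<epsilon> * \<bar>ln y\<bar>) = 1 / u" by (simp add: u_def exp_minus divide_inverse)
          have "1 \<le> u" using True assms by (simp add: u_def)
          then have "1 \<le> u\<^sup>2" by (simp add: one_le_power)
          then have "(1 + u\<^sup>2) / u \<le> 2 * u"
            by (subst pos_divide_le_eq[OF u]) (simp add: power2_eq_square)
          then show ?thesis unfolding eq by simp
        next
          case False
          then have "exp (- \<epsilon> * \<bar>ln y\<bar>) = u" by (simp add: u_def)
          moreover have "u \<le> 1" using False assms by (simp add: u_def mult_nonneg_nonpos)
          then have "u\<^sup>2 \<le> 1" using u by (simp add: power_le_one)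
          then have "u * (1 + u\<^sup>2) \<le> u * 2" using u by (intro mult_left_mono) auto
          ultimately show ?thesis by simp
        qed
        then have "exp (- \<epsilon> * \<bar>ln y\<bar>) \<le> 2 * u / (1 + u\<^sup>2)"
          by (subst pos_le_divide_eq) (auto intro: add_pos_nonneg)
        then have "exp (- \<epsilon> * \<bar>ln y\<bar>) / y \<le> 2 * u / (1 + u\<^sup>2) / y"
          using True by (intro divide_right_mono) auto
        also have "2 * u / (1 + u\<^sup>2) / y = 2 / \<epsilon> * g y"
          using assms by (simp add: g_def u_def[symmetric] mult.commute)
        finally have "exp (- \<epsilon> * \<bar>ln y\<bar>) / y \<le> 2 / \<epsilon> * g y" .
        moreover have "0 \<le> g y" using True assms by (simp add: g_def)
        ultimately show ?thesis using True assms by simp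
      qed simp
    qed
  qed simp
qed


section \<open>Measurability of the integrand\<close>

definition form_measurable :: "'a measure \<Rightarrow> ('a \<Rightarrow> (nat, real) exterior) \<Rightarrow> bool" where
  "form_measurable M F \<longleftrightarrow> (\<forall>I. (\<lambda>y. ecoeff (F y) I) \<in> borel_measurable M)"

lemma form_measurable_fixed: "form_measurable M (\<lambda>_. a)"
  by (simp add: form_measurable_def)

lemma form_measurable_const:
  "a \<in> borel_measurable M \<Longrightarrow> form_measurable M (\<lambda>y. ext_const (a y))"
  by (auto simp: form_measurable_def ext_const.rep_eq)

lemma form_measurable_sum:
  "(\<And>i. i \<in> I \<Longrightarrow> form_measurable M (F i)) \<Longrightarrow> form_measurable M (\<lambda>y. \<Sum>i\<in>I. F i y)"
  unfolding form_measurable_def ecoeff_sum by (intro allI borel_measurable_sum) blast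

lemma form_measurable_mult:
  "form_measurable M F \<Longrightarrow> form_measurable M G \<Longrightarrow> form_measurable M (\<lambda>y. F y * G y)"
  unfolding form_measurable_def ecoeff_mult
  by (intro allI borel_measurable_sum borel_measurable_times) auto

lemma form_measurable_prod_list:
  "(\<And>j. j \<in> set js \<Longrightarrow> form_measurable M (F j)) \<Longrightarrow>
    form_measurable M (\<lambda>y. prod_list (map (\<lambda>j. F j y) js))"
  by (induction js) (simp_all add: form_measurable_fixed form_measurable_mult)

definition mat_measurable ::
    "'a measure \<Rightarrow> nat \<Rightarrow> nat \<Rightarrow> ('a \<Rightarrow> (nat, real) exterior mat) \<Rightarrow> bool" where
  "mat_measurable M nr nc F \<longleftrightarrow> (\<forall>y. F y \<in> carrier_mat nr nc) \<and>
     (\<forall>i<nr. \<forall>j<nc. form_measurable M (\<lambda>y. F y $$ (i, j)))"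

lemma mat_measurable_mult:
  assumes "mat_measurable M nr n F" "mat_measurable M n nc G"
  shows "mat_measurable M nr nc (\<lambda>y. F y * G y)"
proof -
  have c: "F y \<in> carrier_mat nr n" "G y \<in> carrier_mat n nc" for y
    using assms by (auto simp: mat_measurable_def)
  have "form_measurable M (\<lambda>y. (F y * G y) $$ (i, j))" if ij: "i < nr" "j < nc" for i j
    unfolding mult_mat_entry[OF c ij]
    by (intro form_measurable_sum form_measurable_mult) (use assms ij in \<open>auto simp: mat_measurable_def\<close>)
  then show ?thesis using mult_carrier_mat[OF c] by (auto simp: mat_measurable_def)
qed

lemma mat_measurable_pow:
  assumes "mat_measurable M n n F"
  shows "mat_measurable M n n (\<lambda>y. F y ^\<^sub>m m)"
proof (induction m)
  case 0
  have "dim_row (F y) = n" for y using assms by (auto simp: mat_measurable_def)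
  then show ?case by (simp add: mat_measurable_def form_measurable_fixed)
next
  case (Suc m)
  then show ?case using mat_measurable_mult[OF Suc assms] by simp
qed

lemma form_measurable_trace:
  assumes "mat_measurable M n n F"
  shows "form_measurable M (\<lambda>y. mat_trace (F y))"
proof -
  have "dim_row (F y) = n" for y using assms by (auto simp: mat_measurable_def)
  then show ?thesis
    unfolding mat_trace_def using assms by (auto simp: mat_measurable_def intro!: form_measurable_sum)
qed

text \<open>The Leibniz formula expresses the determinant as a polynomial in the entries.\<close>

lemma borel_measurable_det:
  fixes A :: "'a \<Rightarrow> real mat"
  assumes c: "\<And>y. A y \<in> carrier_mat n n"
    and "\<And>i j. i < n \<Longrightarrow> j < n \<Longrightarrow> (\<lambda>y. A y $$ (i, j)) \<in> borel_measurable M"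
  shows "(\<lambda>y. det (A y)) \<in> borel_measurable M"
proof -
  have "p i < n" if "p permutes {0..<n}" "i < n" for p i
    using permutes_in_image[OF that(1), of i] that(2) by simp
  then show ?thesis
    unfolding det_def'[OF c]
    by (intro borel_measurable_sum borel_measurable_times borel_measurable_prod borel_measurable_const assms)
      auto
qed

lemma borel_measurable_adj_mat:
  fixes A :: "'a \<Rightarrow> real mat"
  assumes c: "\<And>y. A y \<in> carrier_mat n n"
    and m: "\<And>i j. i < n \<Longrightarrow> j < n \<Longrightarrow> (\<lambda>y. A y $$ (i, j)) \<in> borel_measurable M"
    and ij: "i < n" "j < n"
  shows "(\<lambda>y. adj_mat (A y) $$ (i, j)) \<in> borel_measurable M"
proof -
  have d: "dim_row (A y) = n" "dim_col (A y) = n" for y using c[of y] by auto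
  have "(\<lambda>y. det (mat_delete (A y) j i)) \<in> borel_measurable M"
  proof (rule borel_measurable_det)
    show "mat_delete (A y) j i \<in> carrier_mat (n - 1) (n - 1)" for y
      using mat_delete_carrier[OF c] .
    show "(\<lambda>y. mat_delete (A y) j i $$ (i', j')) \<in> borel_measurable M" if "i' < n - 1" "j' < n - 1" for i' j'
      unfolding mat_delete_def d using that m by simp
  qed
  then show ?thesis
    unfolding adj_mat_def d using ij by (simp add: cofactor_def)
qed

text \<open>Unlike \<open>inv_laplacian\<close>, the adjugate formula is visibly measurable in \<open>x\<close>.\<close>

definition adj_inverse :: "real mat \<Rightarrow> real mat" where
  "adj_inverse A = (1 / det A) \<cdot>\<^sub>m adj_mat A"

context
  fixes H :: "int mat" and n h :: nat
  assumes H: "H \<in> carrier_mat n h"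
    and inj: "\<And>a. a \<in> carrier_vec h \<Longrightarrow> H *\<^sub>v a = 0\<^sub>v n \<Longrightarrow> a = 0\<^sub>v h"
begin

text \<open>Multiplying \<open>L * adj_mat L = det L \<cdot>\<^sub>m 1\<^sub>m h\<close> by the
  inverse from the left shows that the adjugate is the determinant times the inverse.\<close>

lemma inv_laplacian_eq_adj_inverse:
  assumes x: "\<And>e. e < n \<Longrightarrow> 0 < x e"
  shows "inv_laplacian H x = adj_inverse (laplacian H x)"
proof -
  let ?L = "laplacian H x" and ?W = "inv_laplacian H x"
  note L = laplacian_carrier[OF H, of x]
  note adj = adj_mat[OF L]
  have W: "?W \<in> carrier_mat h h" "?W * ?L = 1\<^sub>m h"
    using inv_laplacian[of H n h x, OF H inj x] by blast+
  have "adj_mat ?L = ?W * ?L * adj_mat ?L" unfolding W(2) using left_mult_one_mat[OF adj(1)] by simp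
  also have "\<dots> = ?W * (det ?L \<cdot>\<^sub>m 1\<^sub>m h)"
    using assoc_mult_mat[OF W(1) L adj(1)] adj(2) by simp
  also have "\<dots> = det ?L \<cdot>\<^sub>m ?W"
    using W(1) by (subst mult_smult_distrib[of _ h h _ h]) auto
  finally have "adj_mat ?L = det ?L \<cdot>\<^sub>m ?W" .
  then show ?thesis
    unfolding adj_inverse_def using det_laplacian[of H n h x, OF H inj x] W(1)
    by (intro eq_matI) auto
qed

text \<open>The differentials of the Laplacian have constant coefficients, and the adjugate formula
  is measurable on the whole space, including points of zero determinant, where
  \<open>1 / det\<close> is 0.\<close>

lemma omega_measurable:
  fixes X :: "'a \<Rightarrow> nat \<Rightarrow> real"
  assumes X: "\<And>e. e < n \<Longrightarrow> (\<lambda>y. X y e) \<in> borel_measurable M"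
  shows "form_measurable M (\<lambda>y. mat_trace
    ((map_mat ext_const (adj_inverse (laplacian H (X y))) * diff_mat n (laplacian H) (X y)) ^\<^sub>m m))"
proof -
  have L: "laplacian H (X y) \<in> carrier_mat h h" for y by (rule laplacian_carrier[OF H])
  have Lm: "(\<lambda>y. laplacian H (X y) $$ (i, j)) \<in> borel_measurable M" if "i < h" "j < h" for i j
    unfolding laplacian_entry[OF H that]
    by (intro borel_measurable_sum borel_measurable_times borel_measurable_const X) auto
  have "adj_inverse (laplacian H (X y)) \<in> carrier_mat h h" for y
    using adj_mat(1)[OF L] by (simp add: adj_inverse_def)
  moreover have "(\<lambda>y. adj_inverse (laplacian H (X y)) $$ (i, j)) \<in> borel_measurable M"
    if ij: "i < h" "j < h" for i j
  proof -
    have "adj_inverse (laplacian H (X y)) $$ (i, j)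
        = 1 / det (laplacian H (X y)) * adj_mat (laplacian H (X y)) $$ (i, j)" for y
      using adj_mat(1)[OF L, of y] ij by (simp add: adj_inverse_def)
    then show ?thesis
      using borel_measurable_det[OF L Lm] borel_measurable_adj_mat[OF L Lm ij] by simp
  qed
  moreover have "map_mat ext_const (adj_inverse (laplacian H (X y))) $$ (i, j)
      = (ext_const (adj_inverse (laplacian H (X y)) $$ (i, j)) :: (nat, real) exterior)" if "i < h" "j < h" for i j y
    using adj_mat(1)[OF L, of y] that by (intro index_map_mat(1)) (simp_all add: adj_inverse_def)
  ultimately have 1: "mat_measurable M h h (\<lambda>y. map_mat ext_const (adj_inverse (laplacian H (X y))))"
    unfolding mat_measurable_def by (simp add: form_measurable_const)
  have "diff_mat n (laplacian H) (X y) $$ (i, j)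
      = (\<Sum>e<n. ext_const (of_int (H $$ (e, i)) * of_int (H $$ (e, j))) * ext_gen e)"
    if "i < h" "j < h" for y i j
    using that L[of y] by (auto simp: diff_mat_def diff_def deriv_laplacian[OF H inj] intro!: sum.cong)
  moreover have "diff_mat n (laplacian H) (X y) \<in> carrier_mat h h" for y
    by (simp add: diff_mat_def carrier_matD[OF L])
  ultimately have 2: "mat_measurable M h h (\<lambda>y. diff_mat n (laplacian H) (X y))"
    unfolding mat_measurable_def by (simp add: form_measurable_fixed)
  show ?thesis
    by (rule form_measurable_trace[OF mat_measurable_pow[OF mat_measurable_mult[OF 1 2]]])
qed

text \<open>The indicator restricts attention to positive coordinates, where the inverse in
  \<open>omega\<close> agrees with the adjugate formula; elsewhere both sides are 0.\<close>

lemma canonical_form_coeff_measurable: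
  fixes X :: "'a \<Rightarrow> nat \<Rightarrow> real"
  assumes X: "\<And>e. e < n \<Longrightarrow> (\<lambda>y. X y e) \<in> borel_measurable M"
    and A: "A \<in> sets M" and pos: "\<And>y e. y \<in> A \<Longrightarrow> e < n \<Longrightarrow> 0 < X y e"
  shows "(\<lambda>y. indicator A y *\<^sub>R ecoeff (canonical_form H \<omega> (X y)) I) \<in> borel_measurable M"
proof -
  define \<Omega> where "\<Omega> j y = mat_trace ((map_mat ext_const (adj_inverse (laplacian H (X y)))
      * diff_mat n (laplacian H) (X y)) ^\<^sub>m (4 * j + 1))" for j y
  define F where "F y = (\<Sum>K | ecoeff \<omega> K \<noteq> 0. ext_const (of_rat (ecoeff \<omega> K)) *
     prod_list (map (\<lambda>j. \<Omega> j y) (sorted_list_of_set K)))" for y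
  have "form_measurable M (\<Omega> j)" for j
    unfolding \<Omega>_def by (rule omega_measurable) (rule X)
  then have "form_measurable M F"
    unfolding F_def
    by (intro form_measurable_sum form_measurable_mult form_measurable_fixed form_measurable_prod_list)
  then have "(\<lambda>y. indicator A y *\<^sub>R ecoeff (F y) I) \<in> borel_measurable M"
    using A by (intro borel_measurable_scaleR borel_measurable_indicator) (simp_all add: form_measurable_def)
  moreover have "indicator A y *\<^sub>R ecoeff (canonical_form H \<omega> (X y)) I = indicator A y *\<^sub>R ecoeff (F y) I" for y
  proof (cases "y \<in> A")
    case True
    have "the (mat_inverse (laplacian H (X y))) = adj_inverse (laplacian H (X y))"
      using inv_laplacian_eq_adj_inverse[of "X y"] pos[OF True] by (simp add: inv_laplacian_def)
    then have "omega H j (X y) = \<Omega> j y" for j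
      using H by (simp add: omega_def \<Omega>_def)
    then show ?thesis by (simp add: canonical_form_def F_def)
  qed simp
  ultimately show ?thesis by (simp only:)
qed

end

section \<open>Convergence of the integral by domination with a product of one-variable
  functions\<close>

theorem theorem2p2:
  fixes G :: "('v, 'e) pre_digraph" and es :: "'e list" and H :: "int mat"
    and \<omega> :: "(nat, rat) exterior" and k :: nat
  assumes "\<omega> \<in> canonical_forms k"
    and "fin_digraph G" and "Digraph_Component.connected G"
    and "card (arcs G) = k + 1"
    and "distinct es" and "set es = arcs G"
    and "H1_basis G es H"
  shows "simplex_integrable k (canonical_form H \<omega>)"
proof -
  define h where "h = dim_col H"
  have "length es = Suc k" using assms(4-6) distinct_card[of es] by simp
  then have H: "H \<in> carrier_mat (Suc k) h"
    using assms(7) by (auto simp: H1_basis_def h_def)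
  have inj: "a = 0\<^sub>v h" if a: "a \<in> carrier_vec h" "H *\<^sub>v a = 0\<^sub>v (Suc k)" for a
  proof -
    have inj_on: "inj_on (\<lambda>a. H *\<^sub>v a) (carrier_vec h)"
      using assms(7) by (auto simp: H1_basis_def h_def bij_betw_def)
    have "H *\<^sub>v 0\<^sub>v h = 0\<^sub>v (Suc k)" using H by (intro eq_vecI) auto
    with a(2) have "H *\<^sub>v a = H *\<^sub>v 0\<^sub>v h" by simp
    from inj_onD[OF inj_on this a(1)] show ?thesis by simp
  qed
  have K: "K \<subseteq> {1..}" if "ecoeff \<omega> K \<noteq> 0" for K
    using assms(1) that by (auto simp: canonical_forms_def)
  obtain \<epsilon> C :: real where \<epsilon>: "0 < \<epsilon>"
    and bound: "\<forall>x. (\<forall>e<k. 0 < x e) \<and> x k = 1 \<longrightarrow>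
      \<bar>ecoeff (canonical_form H \<omega> x) {..<k}\<bar> \<le> C * (\<Prod>e<k. exp (- \<epsilon> * \<bar>ln (x e)\<bar>) / x e)"
    by (rule canonical_form_coeff_bound[OF H inj K])
  interpret product_sigma_finite "\<lambda>_ :: nat. lborel :: real measure" by standard
  let ?M = "\<Pi>\<^sub>M i\<in>{..<k}. (lborel :: real measure)" and ?A = "\<Pi>\<^sub>E i\<in>{..<k}. {0::real<..}"
  let ?f = "\<lambda>y. ecoeff (canonical_form H \<omega> (y(k := 1))) {..<k}"
  let ?g = "\<lambda>t. indicator {0<..} t * (exp (- \<epsilon> * \<bar>ln t\<bar>) / t) :: real"
  \<comment> \<open>The majorant is a product of integrable functions of the separate coordinates,
    hence integrable for the product measure.\<close>
  have "integrable ?M (\<lambda>y. C * (\<Prod>i<k. ?g (y i)))"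
    by (intro integrable_mult_right product_integrable_prod integrable_exp_abs_ln \<epsilon>) auto
  moreover have "(\<lambda>y. indicator ?A y *\<^sub>R ?f y) \<in> borel_measurable ?M"
  proof (rule canonical_form_coeff_measurable[OF H inj])
    fix e assume e: "e < Suc k"
    show "(\<lambda>y. (y(k := 1)) e) \<in> borel_measurable ?M"
    proof (cases "e = k")
      case False
      then have "(\<lambda>y. y e) \<in> measurable ?M lborel" using e by (intro measurable_component_singleton) auto
      then show ?thesis using False by simp
    qed simp
  next
    show "?A \<in> sets ?M" by (intro sets_PiM_I_finite) auto
  next
    fix y e assume "y \<in> ?A" "e < Suc k"
    then show "0 < (y(k := 1)) e" by (cases "e = k") (auto simp: PiE_iff)
  qed
  moreover have "AE y in ?M. norm (indicator ?A y *\<^sub>R ?f y) \<le> norm (C * (\<Prod>i<k. ?g (y i)))"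
  proof (rule AE_I2)
    fix y
    show "norm (indicator ?A y *\<^sub>R ?f y) \<le> norm (C * (\<Prod>i<k. ?g (y i)))"
    proof (cases "y \<in> ?A")
      case True
      then have y: "0 < y i" if "i < k" for i using that by (auto simp: PiE_iff)
      have "\<bar>?f y\<bar> \<le> C * (\<Prod>e<k. exp (- \<epsilon> * \<bar>ln ((y(k := 1)) e)\<bar>) / (y(k := 1)) e)"
        by (rule bound[rule_format]) (use y in auto)
      also have "\<dots> = C * (\<Prod>i<k. ?g (y i))"
        using y by (intro arg_cong[of _ _ "(*) C"] prod.cong) auto
      finally show ?thesis using True by simp
    qed simp
  qed
  ultimately show ?thesis
    unfolding simplex_integrable_def set_integrable_def
    by (rule Bochner_Integration.integrable_bound)
qed

end
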